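(* A planar curve possesses the extendable self-affinity (ESA) with respect to the equiaffine parameterization and the equiaffine transformation group $G^{\mathrm{SA}}$ if and only if it is a curve of constant equiaffine curvature, that is, if and only if it is (an arc of) a parabola, an ellipse, or a hyperbola.
   Context: Identify $\mathbb{C}$ with $\mathbb{R}^2$. A curve is a smooth map $\gamma:I\to\mathbb{C}$ on a nondegenerate interval $I$ with nowhere vanishing derivative; a reparametrization is a smooth homeomorphic change of the parameter interval. Curves are given in arc length parameter $s$ on $[0,s_{\mathrm{all}}]$, where $s_{\mathrm{all}}>0$ is the total length. ESA: a curve $\gamma(s):[0,s_{\mathrm{all}}]\to\mathbb{C}$ possesses the extendable self-affinity with respect to a reparametrization $t=t(s)$ and a Lie group $G$ (of transformations of $\mathbb{C}$) if there exist a supercurve $\tilde\gamma(s):[0,\tilde s_{\mathrm{all}}]\to\mathbb{C}$ of $\gamma$ (a curve containing $\gamma$ as a subcurve, possibly $\gamma$ itself) and a differentiable map $\mathbb{R}\to G$, $\varepsilon\mapsto F_\varepsilon$, such that $$\tilde\gamma(t+\varepsilon)=F_\varepsilon\tilde\gamma(t)\quad\text{for any }t,\varepsilon\text{ with }t,\,t+\varepsilon\in t([0,\tilde s_{\mathrm{all}}]),$$ where $\tilde\gamma$ is regarded as a function of the parameter $t$. A parameter $t$ of a curve is an equiaffine parameterization if $\det(\gamma_t,\gamma_{tt})=1$ (for the ESA, $t$ is an equiaffine parameterization of $\tilde\gamma$; in particular possessing this ESA includes the existence of such a parameterization). The equiaffine transformation group is $G^{\mathrm{SA}}=\{z\mapsto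 Az+b\mid A\in SL(2,\mathbb{R}),\ b\in\mathbb{C}\}$. For an equiaffine parametrized curve, set $\Phi^{\mathrm{SA}}=(\gamma_t,\gamma_{tt})\in SL(2,\mathbb{R})$; the equiaffine curvature $\kappa^{\mathrm{SA}}(t)$ is defined by $$\Phi^{\mathrm{SA}}_t=\Phi^{\mathrm{SA}}\begin{pmatrix}0&-\kappa^{\mathrm{SA}}\\1&0\end{pmatrix},\quad\text{i.e. }\gamma_{ttt}=-\kappa^{\mathrm{SA}}\gamma_t.$$ A curve of constant equiaffine curvature is a curve that admits an equiaffine parameterization for which $\kappa^{\mathrm{SA}}$ is constant. *)

theory Defs
  imports "HOL-Analysis.Analysis"
begin

text \<open>The plane \<open>\<complex> = \<real>\<^sup>2\<close> is rendered as \<^typ>\<open>real^2\<close>.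
  Derivatives on an interval \<open>I\<close> are relative to \<open>I\<close>, hence one-sided at its end points.\<close>

definition deriv_on :: "real set \<Rightarrow> (real \<Rightarrow> 'a::real_normed_vector) \<Rightarrow> real \<Rightarrow> 'a" where
  "deriv_on I f t = vector_derivative f (at t within I)"

definition smooth_on_interval :: "real set \<Rightarrow> (real \<Rightarrow> 'a::real_normed_vector) \<Rightarrow> bool" where
  "smooth_on_interval I f \<longleftrightarrow>
     (\<forall>n. \<forall>t\<in>I. (deriv_on I ^^ n) f differentiable (at t within I))"

definition nondegenerate_interval :: "real set \<Rightarrow> bool" where
  "nondegenerate_interval I \<longleftrightarrow> is_interval I \<and> (\<exists>a\<in>I. \<exists>b\<in>I. a < b)"

definition curve :: "real set \<Rightarrow> (real \<Rightarrow> real^2) \<Rightarrow> bool" where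
  "curve I \<gamma> \<longleftrightarrow> nondegenerate_interval I \<and> smooth_on_interval I \<gamma>
     \<and> (\<forall>t\<in>I. deriv_on I \<gamma> t \<noteq> 0)"

definition arc_length_curve :: "real \<Rightarrow> (real \<Rightarrow> real^2) \<Rightarrow> bool" where
  "arc_length_curve l \<gamma> \<longleftrightarrow>
     l > 0 \<and> curve {0..l} \<gamma> \<and> (\<forall>s\<in>{0..l}. norm (deriv_on {0..l} \<gamma> s) = 1)"

text \<open>Orientation-reversing changes of parameter are allowed. Smoothness of the inverse is not
  demanded here; it is automatic when the reparametrized map is again a curve.\<close>

definition reparametrization :: "real set \<Rightarrow> (real \<Rightarrow> real) \<Rightarrow> bool" where
  "reparametrization I \<phi> \<longleftrightarrow>
     smooth_on_interval I \<phi> \<and> (\<exists>\<psi>. homeomorphism I (\<phi> ` I) \<phi> \<psi>)"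

text \<open>The curve \<open>\<gamma>\<close> regarded as a function, on \<open>\<phi> ` I\<close>, of the parameter \<open>t = \<phi>(s)\<close>.\<close>

definition reparametrize :: "real set \<Rightarrow> (real \<Rightarrow> real) \<Rightarrow> (real \<Rightarrow> real^2) \<Rightarrow> real \<Rightarrow> real^2" where
  "reparametrize I \<phi> \<gamma> t = \<gamma> (the_inv_into I \<phi> t)"

definition supercurve :: "real \<Rightarrow> (real \<Rightarrow> real^2) \<Rightarrow> real \<Rightarrow> (real \<Rightarrow> real^2) \<Rightarrow> bool" where
  "supercurve l' \<gamma>' l \<gamma> \<longleftrightarrow> arc_length_curve l' \<gamma>' \<and>
     (\<exists>s0\<ge>0. s0 + l \<le> l' \<and> (\<forall>s\<in>{0..l}. \<gamma> s = \<gamma>' (s0 + s)))"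

text \<open>An affine transformation \<open>z \<mapsto> A z + b\<close> is represented by the pair \<open>(A, b)\<close>, which it
  determines. A Lie group of such transformations is thereby a subset of a normed space, and a map
  \<open>\<real> \<rightarrow> G\<close> is differentiable iff it is so as a map into this normed space.\<close>

type_synonym affine_map = "(real^2^2) \<times> (real^2)"

definition aff_apply :: "affine_map \<Rightarrow> real^2 \<Rightarrow> real^2" where
  "aff_apply F z = fst F *v z + snd F"

definition equiaffine_group :: "affine_map set" where
  "equiaffine_group = {(A, b). det A = 1}"

text \<open>Extendable self-affinity. The predicate \<open>P I \<gamma> \<phi>\<close> specifies the kind of parameter, i.e. which
  reparametrizations \<open>\<phi>\<close> of a curve \<open>\<gamma>\<close> on \<open>I\<close> are admitted; it is imposed on the supercurve.\<close>

definition possesses_ESA ::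
  "(real set \<Rightarrow> (real \<Rightarrow> real^2) \<Rightarrow> (real \<Rightarrow> real) \<Rightarrow> bool) \<Rightarrow> affine_map set
     \<Rightarrow> real \<Rightarrow> (real \<Rightarrow> real^2) \<Rightarrow> bool" where
  "possesses_ESA P G l \<gamma> \<longleftrightarrow>
     (\<exists>l' \<gamma>' \<phi> F.
        supercurve l' \<gamma>' l \<gamma> \<and>
        reparametrization {0..l'} \<phi> \<and> P {0..l'} \<gamma>' \<phi> \<and>
        (\<forall>\<epsilon>. F \<epsilon> \<in> G) \<and> F differentiable_on UNIV \<and>
        (\<forall>t \<epsilon>. t \<in> \<phi> ` {0..l'} \<and> t + \<epsilon> \<in> \<phi> ` {0..l'} \<longrightarrow>
           reparametrize {0..l'} \<phi> \<gamma>' (t + \<epsilon>)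
             = aff_apply (F \<epsilon>) (reparametrize {0..l'} \<phi> \<gamma>' t)))"

definition col_matrix :: "real^2 \<Rightarrow> real^2 \<Rightarrow> real^2^2" where
  "col_matrix u v = transpose (vector [u, v])"

definition equiaffine_frame :: "real set \<Rightarrow> (real \<Rightarrow> real^2) \<Rightarrow> real \<Rightarrow> real^2^2" where
  "equiaffine_frame J c t = col_matrix (deriv_on J c t) (deriv_on J (deriv_on J c) t)"

definition equiaffine_parametrized :: "real set \<Rightarrow> (real \<Rightarrow> real^2) \<Rightarrow> bool" where
  "equiaffine_parametrized J c \<longleftrightarrow> curve J c \<and> (\<forall>t\<in>J. det (equiaffine_frame J c t) = 1)"

definition equiaffine_parameter :: "real set \<Rightarrow> (real \<Rightarrow> real^2) \<Rightarrow> (real \<Rightarrow> real) \<Rightarrow> bool" where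
  "equiaffine_parameter I \<gamma> \<phi> \<longleftrightarrow>
     reparametrization I \<phi> \<and> equiaffine_parametrized (\<phi> ` I) (reparametrize I \<phi> \<gamma>)"

text \<open>Existence and uniqueness of the described value for an equiaffine parametrized \<open>c\<close> and
  \<open>t \<in> J\<close> follow from differentiating \<open>det (c\<^sub>t, c\<^sub>t\<^sub>t) = 1\<close>.\<close>

definition equiaffine_curvature :: "real set \<Rightarrow> (real \<Rightarrow> real^2) \<Rightarrow> real \<Rightarrow> real" where
  "equiaffine_curvature J c t =
     (THE \<kappa>. deriv_on J (equiaffine_frame J c) t
              = equiaffine_frame J c t ** vector [vector [0, - \<kappa>], vector [1, 0]])"

definition constant_equiaffine_curvature :: "real set \<Rightarrow> (real \<Rightarrow> real^2) \<Rightarrow> bool" where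
  "constant_equiaffine_curvature I \<gamma> \<longleftrightarrow>
     (\<exists>\<phi>. equiaffine_parameter I \<gamma> \<phi> \<and>
        (\<exists>k. \<forall>t\<in>\<phi> ` I. equiaffine_curvature (\<phi> ` I) (reparametrize I \<phi> \<gamma>) t = k))"

definition congruent_sets :: "(real^2) set \<Rightarrow> (real^2) set \<Rightarrow> bool" where
  "congruent_sets S T \<longleftrightarrow> (\<exists>R c. orthogonal_matrix R \<and> S = (\<lambda>z. R *v z + c) ` T)"

definition parabola :: "(real^2) set \<Rightarrow> bool" where
  "parabola S \<longleftrightarrow> (\<exists>a>0. congruent_sets S {z. z$2 = a * (z$1)\<^sup>2})"

definition ellipse :: "(real^2) set \<Rightarrow> bool" where
  "ellipse S \<longleftrightarrow> (\<exists>a>0. \<exists>b>0. congruent_sets S {z. (z$1)\<^sup>2 / a\<^sup>2 + (z$2)\<^sup>2 / b\<^sup>2 = 1})"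

definition hyperbola :: "(real^2) set \<Rightarrow> bool" where
  "hyperbola S \<longleftrightarrow> (\<exists>a>0. \<exists>b>0. congruent_sets S {z. (z$1)\<^sup>2 / a\<^sup>2 - (z$2)\<^sup>2 / b\<^sup>2 = 1})"

text \<open>A regular curve is an arc of a conic iff it runs inside it. Injectivity is not required, as
  a curve may run around an ellipse several times.\<close>

definition arc_of :: "real set \<Rightarrow> (real \<Rightarrow> real^2) \<Rightarrow> (real^2) set \<Rightarrow> bool" where
  "arc_of I \<gamma> S \<longleftrightarrow> curve I \<gamma> \<and> \<gamma> ` I \<subseteq> S"

end

theory Submission
  imports Defs
begin

text \<open>All three conditions are equivalent to a common normal form
  \<open>\<gamma> = p + gsin k u e1 + gver k u e2\<close> with linearly independent \<open>e1\<close>, \<open>e2\<close> and a smooth \<open>u\<close>, where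
  \<open>gsin k\<close> and \<open>gver k\<close> are the sine and the versine of curvature \<open>k\<close>; they parametrize the conic
  \<open>x\<^sup>2 + k y\<^sup>2 = 2 y\<close>, which is a parabola, an ellipse or a hyperbola according to the sign of \<open>k\<close>.
  Constant equiaffine curvature means the linear equation \<open>c''' = - k c'\<close>, whose solutions have this
  form with \<open>u\<close> affine. Differentiating \<open>c(t + \<epsilon>) = F\<^sub>\<epsilon> c(t)\<close> three times gives
  \<open>c'''(t + \<epsilon>) = A c'''(t)\<close> and \<open>c'(t + \<epsilon>) = A c'(t)\<close>, so the curvatures at \<open>t\<close> and \<open>t + \<epsilon>\<close> agree;
  conversely, the equation is invariant under shifts, so a shift of its solution is an affine motion.
  A curve inside a conic satisfies \<open>x\<^sup>2 + k y\<^sup>2 = 2 y\<close> in affine coordinates, and \<open>u\<close> is obtained by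
  integrating \<open>u' = (1 - k y) x' + k x y'\<close>; the conic of a normal form is found by rotating to
  principal axes.\<close>

section \<open>Smooth functions on an interval\<close>

lemma nondegenerate_interval_Icc: "a < b \<Longrightarrow> nondegenerate_interval {a..b::real}"
  unfolding nondegenerate_interval_def by (metis atLeastAtMost_iff is_interval_cc less_eq_real_def)

text \<open>A connected set with more than one point has no isolated points. This is what makes
  derivatives relative to \<open>I\<close> unique, also at end points.\<close>

lemma at_within_nondegenerate_interval:
  assumes "nondegenerate_interval I" "t \<in> I"
  shows "at t within I \<noteq> bot"
proof -
  have "connected I" using assms unfolding nondegenerate_interval_def is_interval_connected_1 by blast
  moreover have "I \<noteq> {x}" for x using assms unfolding nondegenerate_interval_def by auto
  ultimately have "t islimpt I" using connected_imp_perfect assms(2) by blast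
  then show ?thesis using trivial_limit_within by blast
qed

lemma deriv_on_eqI:
  assumes "nondegenerate_interval I" "t \<in> I" "(f has_vector_derivative D) (at t within I)"
  shows "deriv_on I f t = D"
  unfolding deriv_on_def
  using assms at_within_nondegenerate_interval vector_derivative_within by blast

lemma deriv_on_cong:
  assumes "\<And>t. t \<in> I \<Longrightarrow> f t = g t" "t \<in> I"
  shows "deriv_on I f t = deriv_on I g t"
proof -
  have "(f has_vector_derivative D) (at t within I) \<longleftrightarrow> (g has_vector_derivative D) (at t within I)" for D
    using assms by (metis has_vector_derivative_transform)
  then show ?thesis unfolding deriv_on_def vector_derivative_def by simp
qed

lemma differentiable_cong_on:
  assumes "\<And>t. t \<in> I \<Longrightarrow> f t = g t" "t \<in> I" "f differentiable (at t within I)"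
  shows "g differentiable (at t within I)"
  using assms unfolding differentiable_def by (metis has_derivative_transform)

text \<open>By induction on \<open>n\<close>, the \<open>n\<close>-th derivative agrees on
  \<open>I\<close> with some member of \<open>P\<close>. Agreement on \<open>I\<close> suffices,
  since \<open>deriv_on I\<close> at a point of \<open>I\<close> sees only values on
  \<open>I\<close>.\<close>

lemma smooth_on_interval_coinduct:
  assumes I: "nondegenerate_interval I" and "P f"
    and step: "\<And>f. P f \<Longrightarrow> \<exists>g. P g \<and> (\<forall>t\<in>I. (f has_vector_derivative g t) (at t within I))"
  shows "smooth_on_interval I f"
proof -
  have *: "\<exists>g. P g \<and> (\<forall>t\<in>I. (deriv_on I ^^ n) f t = g t)" for n
  proof (induction n)
    case 0
    show ?case using \<open>P f\<close> by auto
  next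
    case (Suc n)
    then obtain g where g: "P g" "\<forall>t\<in>I. (deriv_on I ^^ n) f t = g t" by blast
    from step[OF g(1)] obtain h where h: "P h" "\<forall>t\<in>I. (g has_vector_derivative h t) (at t within I)"
      by blast
    have "(deriv_on I ^^ Suc n) f t = h t" if t: "t \<in> I" for t
    proof -
      have "(deriv_on I ^^ Suc n) f t = deriv_on I g t"
        using deriv_on_cong[of I "(deriv_on I ^^ n) f" g t] g t by simp
      also have "\<dots> = h t" using deriv_on_eqI[OF I t] h t by blast
      finally show ?thesis .
    qed
    then show ?case using h by blast
  qed
  show ?thesis unfolding smooth_on_interval_def
  proof (intro allI ballI)
    fix n t assume t: "t \<in> I"
    from * obtain g where g: "P g" "\<forall>t\<in>I. (deriv_on I ^^ n) f t = g t" by blast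
    from step[OF g(1)] t have "g differentiable (at t within I)"
      by (metis differentiableI_vector)
    then show "(deriv_on I ^^ n) f differentiable (at t within I)"
      using differentiable_cong_on[of I g "(deriv_on I ^^ n) f" t] g t by simp
  qed
qed

lemma smooth_on_interval_deriv:
  assumes "smooth_on_interval I f"
  shows "smooth_on_interval I (deriv_on I f)"
  unfolding smooth_on_interval_def
proof (intro allI)
  fix n
  show "\<forall>t\<in>I. (deriv_on I ^^ n) (deriv_on I f) differentiable (at t within I)"
    using assms[unfolded smooth_on_interval_def, rule_format, of _ "Suc n"]
    by (simp add: funpow_swap1)
qed

lemma smooth_on_interval_has_deriv:
  assumes "smooth_on_interval I f" "t \<in> I"
  shows "(f has_vector_derivative deriv_on I f t) (at t within I)"
  using assms(1)[unfolded smooth_on_interval_def, rule_format, of t 0] assms(2)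
  unfolding deriv_on_def by (simp add: vector_derivative_works)

text \<open>The invariant consists of \<open>f\<close> together with all smooth functions: one
  differentiation leads from \<open>f\<close> into the smooth ones, which are closed under
  \<open>deriv_on I\<close>.\<close>

lemma smooth_on_interval_antiderivative:
  assumes I: "nondegenerate_interval I" and g: "smooth_on_interval I g"
    and f: "\<And>t. t \<in> I \<Longrightarrow> (f has_vector_derivative g t) (at t within I)"
  shows "smooth_on_interval I f"
proof (rule smooth_on_interval_coinduct[OF I, where P = "\<lambda>h. h = f \<or> smooth_on_interval I h"])
  fix h assume "h = f \<or> smooth_on_interval I h"
  then show "\<exists>g. (g = f \<or> smooth_on_interval I g) \<and> (\<forall>t\<in>I. (h has_vector_derivative g t) (at t within I))"
    using f g smooth_on_interval_deriv smooth_on_interval_has_deriv by blast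
qed simp

lemma smooth_on_interval_bounded_linear:
  assumes I: "nondegenerate_interval I" and f: "smooth_on_interval I f" and T: "bounded_linear T"
  shows "smooth_on_interval I (\<lambda>t. T (f t) + c)"
proof (rule smooth_on_interval_coinduct[OF I,
      where P = "\<lambda>h. \<exists>f c. smooth_on_interval I f \<and> h = (\<lambda>t. T (f t) + c)"])
  fix h assume "\<exists>f c. smooth_on_interval I f \<and> h = (\<lambda>t. T (f t) + c)"
  then obtain f c where f: "smooth_on_interval I f" and h: "h = (\<lambda>t. T (f t) + c)" by blast
  have "(h has_vector_derivative (T (deriv_on I f t) + 0)) (at t within I)" if "t \<in> I" for t
    unfolding h using bounded_linear.has_vector_derivative[OF T smooth_on_interval_has_deriv[OF f that]]
    by (intro has_vector_derivative_add) auto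
  then show "\<exists>g. (\<exists>f c. smooth_on_interval I f \<and> g = (\<lambda>t. T (f t) + c)) \<and>
      (\<forall>t\<in>I. (h has_vector_derivative g t) (at t within I))"
    using smooth_on_interval_deriv[OF f] by (intro exI[of _ "\<lambda>t. T (deriv_on I f t) + 0"]) blast
qed (use f in blast)

text \<open>The coinduction invariant for smoothness of products.\<close>

inductive smooth_generated :: "real set \<Rightarrow> (real \<Rightarrow> real) \<Rightarrow> bool" for I where
  base: "smooth_on_interval I f \<Longrightarrow> smooth_generated I f"
| add: "smooth_generated I f \<Longrightarrow> smooth_generated I g \<Longrightarrow> smooth_generated I (\<lambda>t. f t + g t)"
| mult: "smooth_generated I f \<Longrightarrow> smooth_generated I g \<Longrightarrow> smooth_generated I (\<lambda>t. f t * g t)"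

text \<open>The Leibniz rule turns a product into a sum of products, so a class closed under both
  operations contains a derivative of each of its members.\<close>

lemma smooth_generated_imp_smooth:
  assumes I: "nondegenerate_interval I" and "smooth_generated I f"
  shows "smooth_on_interval I f"
proof (rule smooth_on_interval_coinduct[OF I, of "smooth_generated I"])
  fix f assume "smooth_generated I f"
  then show "\<exists>g. smooth_generated I g \<and> (\<forall>t\<in>I. (f has_vector_derivative g t) (at t within I))"
  proof induction
    case (base f)
    then show ?case
      using smooth_generated.base smooth_on_interval_deriv smooth_on_interval_has_deriv by blast
  next
    case (add f g)
    then obtain f' g' where "smooth_generated I f'" "smooth_generated I g'"
      "\<forall>t\<in>I. (f has_vector_derivative f' t) (at t within I)"
      "\<forall>t\<in>I. (g has_vector_derivative g' t) (at t within I)" by blast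
    then show ?case
      by (intro exI[of _ "\<lambda>t. f' t + g' t"])
        (auto intro: smooth_generated.add has_vector_derivative_add)
  next
    case (mult f g)
    then obtain f' g' where "smooth_generated I f'" "smooth_generated I g'"
      "\<forall>t\<in>I. (f has_vector_derivative f' t) (at t within I)"
      "\<forall>t\<in>I. (g has_vector_derivative g' t) (at t within I)" by blast
    then show ?case using mult.hyps
      by (intro exI[of _ "\<lambda>t. f t * g' t + f' t * g t"])
        (auto intro!: smooth_generated.add smooth_generated.mult has_vector_derivative_mult)
  qed
qed fact

lemma has_vector_derivative_shift:
  fixes f :: "real \<Rightarrow> 'a::real_normed_vector"
  assumes f: "(f has_vector_derivative D) (at (a + t) within J)" and sub: "(\<lambda>t. a + t) ` I \<subseteq> J"
  shows "((\<lambda>t. f (a + t)) has_vector_derivative D) (at t within I)"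
proof -
  have "((\<lambda>t. a + t) has_vector_derivative 1) (at t within I)"
    by (auto intro!: derivative_eq_intros)
  from vector_diff_chain_within[OF this has_vector_derivative_within_subset[OF f sub]]
  show ?thesis by (simp add: o_def)
qed

text \<open>Inclusion instead of equality of the intervals allows an arc to inherit smoothness from
  its supercurve.\<close>

lemma smooth_on_interval_shift:
  fixes f :: "real \<Rightarrow> 'a::real_normed_vector"
  assumes f: "smooth_on_interval J f" and I: "nondegenerate_interval I"
    and sub: "(\<lambda>t. a + t) ` I \<subseteq> J"
  shows "smooth_on_interval I (\<lambda>t. f (a + t))"
proof (rule smooth_on_interval_coinduct[OF I,
      where P = "\<lambda>h. \<exists>f. smooth_on_interval J f \<and> h = (\<lambda>t. f (a + t))"])
  fix h :: "real \<Rightarrow> 'a"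
  assume "\<exists>f. smooth_on_interval J f \<and> h = (\<lambda>t. f (a + t))"
  then obtain f where f: "smooth_on_interval J f" and h: "h = (\<lambda>t. f (a + t))" by blast
  have "(h has_vector_derivative deriv_on J f (a + t)) (at t within I)" if t: "t \<in> I" for t
    unfolding h
    by (rule has_vector_derivative_shift[OF smooth_on_interval_has_deriv[OF f] sub])
      (use sub t in auto)
  then show "\<exists>g. (\<exists>f. smooth_on_interval J f \<and> g = (\<lambda>t. f (a + t))) \<and>
      (\<forall>t\<in>I. (h has_vector_derivative g t) (at t within I))"
    using smooth_on_interval_deriv[OF f] by (intro exI[of _ "\<lambda>t. deriv_on J f (a + t)"]) blast
qed (use f in blast)

section \<open>Generalized sine and versine\<close>

text \<open>For each sign of \<open>k\<close> this is the solution of \<open>S'' = - k S\<close>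
  with \<open>S 0 = 0\<close> and \<open>S' 0 = 1\<close>.\<close>

definition gsin :: "real \<Rightarrow> real \<Rightarrow> real" where
  "gsin k t = (if k = 0 then t else if k > 0 then sin (sqrt k * t) / sqrt k
     else sinh (sqrt (- k) * t) / sqrt (- k))"

text \<open>The antiderivative of \<open>gsin k\<close> vanishing at 0. The cosine is
  \<open>1 - k * gver k\<close>; at \<open>k = 0\<close> it degenerates to the constant 1, whereas
  the versine keeps the quadratic term of the parabola.\<close>

definition gver :: "real \<Rightarrow> real \<Rightarrow> real" where
  "gver k t = (if k = 0 then t\<^sup>2 / 2 else if k > 0 then (1 - cos (sqrt k * t)) / k
     else (1 - cosh (sqrt (- k) * t)) / k)"

lemma gsin_0 [simp]: "gsin k 0 = 0" and gver_0 [simp]: "gver k 0 = 0"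
  by (auto simp: gsin_def gver_def)

lemma DERIV_gsin: "(gsin k has_real_derivative 1 - k * gver k t) (at t)"
proof -
  consider "k = 0" | "k > 0" | "k < 0" by linarith
  then show ?thesis
  proof cases
    case 1
    then show ?thesis unfolding gsin_def gver_def by (auto intro!: derivative_eq_intros)
  next
    case 2
    then show ?thesis unfolding gsin_def gver_def
      by (auto intro!: derivative_eq_intros simp: field_simps)
  next
    case 3
    then have "- (cosh (sqrt (- k) * t) * sqrt (- k) * sqrt (- k) / k) = cosh (sqrt (- k) * t)"
      using real_sqrt_mult_self[of "- k"] by (simp add: mult.assoc)
    with 3 show ?thesis unfolding gsin_def gver_def by (auto intro!: derivative_eq_intros)
  qed
qed

lemma DERIV_gver: "(gver k has_real_derivative gsin k t) (at t)"
proof -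
  consider "k = 0" | "k > 0" | "k < 0" by linarith
  then show ?thesis
  proof cases
    case 1
    then show ?thesis unfolding gsin_def gver_def by (auto intro!: derivative_eq_intros)
  next
    case 2
    have "sin (sqrt k * t) * sqrt k / k = sin (sqrt k * t) / sqrt k"
      using 2 by (simp add: field_simps)
    then show ?thesis
      unfolding gsin_def gver_def using 2 by (auto intro!: derivative_eq_intros)
  next
    case 3
    have "- (sinh (sqrt (- k) * t) * sqrt (- k) / k) = sinh (sqrt (- k) * t) / sqrt (- k)"
      using 3 real_sqrt_mult_self[of "- k"] by (simp add: field_simps flip: mult.assoc)
    then show ?thesis
      unfolding gsin_def gver_def using 3 by (auto intro!: derivative_eq_intros)
  qed
qed

lemma has_real_derivative_gsin [derivative_intros]:
  "(g has_real_derivative g') (at x within S) \<Longrightarrow>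
    ((\<lambda>x. gsin k (g x)) has_real_derivative (1 - k * gver k (g x)) * g') (at x within S)"
  by (rule DERIV_chain2[OF DERIV_gsin])

lemma has_real_derivative_gver [derivative_intros]:
  "(g has_real_derivative g') (at x within S) \<Longrightarrow>
    ((\<lambda>x. gver k (g x)) has_real_derivative gsin k (g x) * g') (at x within S)"
  by (rule DERIV_chain2[OF DERIV_gver])

text \<open>Both sides vanish at 0, and since the derivative of \<open>gsin k\<close> is
  \<open>1 - k * gver k\<close>, their difference has derivative 0.\<close>

lemma gsin_gver_conic: "(gsin k t)\<^sup>2 + k * (gver k t)\<^sup>2 = 2 * gver k t"
proof -
  have "((\<lambda>t. (gsin k t)\<^sup>2 + k * (gver k t)\<^sup>2 - 2 * gver k t) has_real_derivative 0) (at t within UNIV)" for t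
    by (rule derivative_eq_intros refl | simp add: algebra_simps)+
  from DERIV_isconst_all[OF allI, OF this, of t 0] show ?thesis by simp
qed

text \<open>This is \<open>k\<close> times the conic equation with the square completed.\<close>

lemma gsin_gver_pythagoras: "(1 - k * gver k t)\<^sup>2 + k * (gsin k t)\<^sup>2 = 1"
  using arg_cong[OF gsin_gver_conic[of k t], of "(*) k"]
  by (simp add: power2_eq_square algebra_simps)

text \<open>\<open>P\<close> and \<open>Q\<close> undo the flow of the pair \<open>(V, W)\<close> and are therefore constant.\<close>

lemma frenet_solution:
  fixes \<gamma> V W :: "real \<Rightarrow> 'a::real_normed_vector" and u u' :: "real \<Rightarrow> real"
  assumes I: "convex I" and s: "s0 \<in> I" "s \<in> I"
    and u: "\<And>s. s \<in> I \<Longrightarrow> (u has_real_derivative u' s) (at s within I)"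
    and \<gamma>: "\<And>s. s \<in> I \<Longrightarrow> (\<gamma> has_vector_derivative u' s *\<^sub>R V s) (at s within I)"
    and V: "\<And>s. s \<in> I \<Longrightarrow> (V has_vector_derivative u' s *\<^sub>R W s) (at s within I)"
    and W: "\<And>s. s \<in> I \<Longrightarrow> (W has_vector_derivative - (k * u' s) *\<^sub>R V s) (at s within I)"
  shows "\<gamma> s = \<gamma> s0 + gsin k (u s - u s0) *\<^sub>R V s0 + gver k (u s - u s0) *\<^sub>R W s0"
proof -
  define S where "S s = gsin k (u s - u s0)" for s
  define U where "U s = gver k (u s - u s0)" for s
  define P where "P s = (1 - k * U s) *\<^sub>R V s - S s *\<^sub>R W s" for s
  define Q where "Q s = (k * S s) *\<^sub>R V s + (1 - k * U s) *\<^sub>R W s" for s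
  have S: "(S has_real_derivative (1 - k * U s) * u' s) (at s within I)"
    and U: "(U has_real_derivative S s * u' s) (at s within I)"
    and C: "((\<lambda>s. 1 - k * U s) has_real_derivative - (k * (S s * u' s))) (at s within I)"
    if "s \<in> I" for s
    using has_real_derivative_gsin[of "\<lambda>s. u s - u s0" "u' s" s I k]
      has_real_derivative_gver[of "\<lambda>s. u s - u s0" "u' s" s I k] u[OF that]
    unfolding S_def U_def by (auto intro!: derivative_eq_intros)
  have "(P has_vector_derivative 0) (at s within I)" if "s \<in> I" for s
    unfolding P_def
    using has_vector_derivative_diff[OF has_vector_derivative_scaleR[OF C[OF that] V[OF that]]
      has_vector_derivative_scaleR[OF S[OF that] W[OF that]]]
    by (simp add: algebra_simps)
  from has_vector_derivative_zero_constant[OF I this]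
  obtain p where "\<And>s. s \<in> I \<Longrightarrow> P s = p" by blast
  moreover have "P s0 = V s0" by (simp add: P_def S_def U_def)
  ultimately have P: "P s = V s0" if "s \<in> I" for s
    using s(1) that by metis
  have "(Q has_vector_derivative 0) (at s within I)" if "s \<in> I" for s
    unfolding Q_def
    using has_vector_derivative_add[OF has_vector_derivative_scaleR[OF DERIV_cmult[OF S[OF that], of k] V[OF that]]
      has_vector_derivative_scaleR[OF C[OF that] W[OF that]]]
    by (simp add: algebra_simps)
  from has_vector_derivative_zero_constant[OF I this]
  obtain q where "\<And>s. s \<in> I \<Longrightarrow> Q s = q" by blast
  moreover have "Q s0 = W s0" by (simp add: Q_def S_def U_def)
  ultimately have Q: "Q s = W s0" if "s \<in> I" for s
    using s(1) that by metis
  have V_eq: "V s = (1 - k * U s) *\<^sub>R V s0 + S s *\<^sub>R W s0" if "s \<in> I" for s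
  proof -
    \<comment> \<open>Solves \<open>P s = V s0\<close>, \<open>Q s = W s0\<close> for
      \<open>V s\<close>; the determinant of this linear system is 1 by
      \<open>gsin_gver_pythagoras\<close>.\<close>
    have "(1 - k * U s) *\<^sub>R V s0 + S s *\<^sub>R W s0 = (1 - k * U s) *\<^sub>R P s + S s *\<^sub>R Q s"
      using P Q that by simp
    also have "\<dots> = ((1 - k * U s)\<^sup>2 + k * (S s)\<^sup>2) *\<^sub>R V s"
      unfolding P_def Q_def by (simp add: algebra_simps power2_eq_square flip: scaleR_2)
    also have "\<dots> = V s" unfolding S_def U_def gsin_gver_pythagoras by simp
    finally show ?thesis by simp
  qed
  \<comment> \<open>With \<open>V s\<close> written in the fixed vectors \<open>V s0\<close> and
    \<open>W s0\<close>, the derivative \<open>u' s *\<^sub>R V s\<close> of \<gamma> is exactly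
    that of the two subtracted terms.\<close>
  have "((\<lambda>s. \<gamma> s - S s *\<^sub>R V s0 - U s *\<^sub>R W s0) has_vector_derivative 0) (at s within I)"
    if "s \<in> I" for s
    using has_vector_derivative_diff[OF has_vector_derivative_diff[OF \<gamma>[OF that]
        has_vector_derivative_scaleR[OF S[OF that] has_vector_derivative_const[of "V s0"]]]
        has_vector_derivative_scaleR[OF U[OF that] has_vector_derivative_const[of "W s0"]]]
    by (simp add: V_eq[OF that] algebra_simps)
  from has_vector_derivative_zero_constant[OF I this]
  obtain c where "\<And>s. s \<in> I \<Longrightarrow> \<gamma> s - S s *\<^sub>R V s0 - U s *\<^sub>R W s0 = c" by blast
  from this[OF s(1)] this[OF s(2)] have "\<gamma> s - S s *\<^sub>R V s0 - U s *\<^sub>R W s0 = \<gamma> s0"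
    unfolding S_def U_def by simp
  then show ?thesis unfolding S_def U_def by (simp add: algebra_simps)
qed

section \<open>Equiaffine curvature\<close>

lemma det_col_matrix: "det (col_matrix u v) = u$1 * v$2 - u$2 * v$1"
  by (simp add: col_matrix_def det_2 transpose_def)

lemma col_matrix_eq_iff: "col_matrix u v = col_matrix u' v' \<longleftrightarrow> u = u' \<and> v = v'"
  by (auto simp: col_matrix_def vec_eq_iff forall_2 transpose_def)

lemma matrix_mult_col_matrix: "A ** col_matrix u v = col_matrix (A *v u) (A *v v)"
  by (simp add: col_matrix_def vec_eq_iff forall_2 transpose_def matrix_matrix_mult_def
      matrix_vector_mult_def)

lemma col_matrix_mult: "col_matrix u v *v w = w$1 *\<^sub>R u + w$2 *\<^sub>R v"
  by (simp add: col_matrix_def vec_eq_iff forall_2 transpose_def matrix_vector_mult_def sum_2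
      algebra_simps)

lemma det_col_matrix_combination:
  "det (col_matrix (a *\<^sub>R e1 + b *\<^sub>R e2) (c *\<^sub>R e1 + d *\<^sub>R e2)) = (a * d - b * c) * det (col_matrix e1 e2)"
  by (simp add: det_col_matrix algebra_simps)

lemma linear_col_matrix: "linear (\<lambda>p. col_matrix (fst p) (snd p))"
  by (rule linearI)
    (auto simp: col_matrix_def vec_eq_iff forall_2 transpose_def)

lemma has_vector_derivative_col_matrix:
  assumes "(f has_vector_derivative f') (at x within S)" "(g has_vector_derivative g') (at x within S)"
  shows "((\<lambda>t. col_matrix (f t) (g t)) has_vector_derivative col_matrix f' g') (at x within S)"
  using bounded_linear.has_vector_derivative[OF linear_col_matrix[unfolded linear_conv_bounded_linear]
      has_vector_derivative_Pair[OF assms]] by simp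

lemma has_real_derivative_vec_nth:
  assumes "(f has_vector_derivative f') (at x within S)"
  shows "((\<lambda>t. f t $ i) has_real_derivative f' $ i) (at x within S)"
  using bounded_linear.has_vector_derivative[OF bounded_linear_vec_nth assms]
  by (simp add: has_real_derivative_iff_has_vector_derivative)

lemma cramer_col_matrix:
  assumes "det (col_matrix e1 e2) \<noteq> 0"
  shows "z = (det (col_matrix z e2) / det (col_matrix e1 e2)) *\<^sub>R e1
           + (det (col_matrix e1 z) / det (col_matrix e1 e2)) *\<^sub>R e2"
proof -
  have "det (col_matrix e1 e2) * z $ i
      = det (col_matrix z e2) * e1 $ i + det (col_matrix e1 z) * e2 $ i" for i
    using exhaust_2[of i] by (auto simp: det_col_matrix algebra_simps)
  with assms show ?thesis by (simp add: vec_eq_iff field_simps)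
qed

lemma nondegenerate_interval_convex: "nondegenerate_interval I \<Longrightarrow> convex I"
  by (simp add: nondegenerate_interval_def is_interval_convex)

lemma equiaffine_frame_has_derivative:
  assumes "smooth_on_interval J c" "t \<in> J"
  shows "(equiaffine_frame J c has_vector_derivative
    col_matrix (deriv_on J (deriv_on J c) t) (deriv_on J (deriv_on J (deriv_on J c)) t)) (at t within J)"
  unfolding equiaffine_frame_def
  using assms
  by (intro has_vector_derivative_col_matrix smooth_on_interval_has_deriv smooth_on_interval_deriv)

text \<open>Differentiating \<open>det (c', c'') = 1\<close> gives
  \<open>det (c', c''') = 0\<close>, so \<open>c'''\<close> is a multiple of \<open>c'\<close>. The
  factor is unique because \<open>c'\<close> does not vanish; hence the definite description denotes
  it.\<close>

lemma equiaffine_curvature_iff: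
  assumes c: "equiaffine_parametrized J c" and t: "t \<in> J"
  shows "equiaffine_curvature J c t = k \<longleftrightarrow>
    deriv_on J (deriv_on J (deriv_on J c)) t = - k *\<^sub>R deriv_on J c t"
proof -
  let ?c1 = "deriv_on J c" and ?c2 = "deriv_on J (deriv_on J c)"
  let ?c3 = "deriv_on J (deriv_on J (deriv_on J c))"
  have J: "nondegenerate_interval J" and sm: "smooth_on_interval J c" and nz: "?c1 t \<noteq> 0"
    and det1: "\<And>t. t \<in> J \<Longrightarrow> ?c1 t $ 1 * ?c2 t $ 2 - ?c1 t $ 2 * ?c2 t $ 1 = 1"
    using c t by (auto simp: equiaffine_parametrized_def curve_def equiaffine_frame_def det_col_matrix)
  have "vector [vector [0, - \<kappa>], vector [1, 0]]
      = col_matrix (vector [0, 1]) (vector [- \<kappa>, 0])" for \<kappa> :: real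
    by (auto simp: col_matrix_def vec_eq_iff forall_2 transpose_def)
  then have eq: "deriv_on J (equiaffine_frame J c) t
      = equiaffine_frame J c t ** vector [vector [0, - \<kappa>], vector [1, 0]] \<longleftrightarrow> ?c3 t = - \<kappa> *\<^sub>R ?c1 t"
    for \<kappa>
    unfolding deriv_on_eqI[OF J t equiaffine_frame_has_derivative[OF sm t]]
    by (simp add: matrix_mult_col_matrix equiaffine_frame_def col_matrix_mult col_matrix_eq_iff)
  have "?c1 t $ 1 * ?c3 t $ 2 - ?c1 t $ 2 * ?c3 t $ 1 = 0"
  proof -
    have d: "(?c1 has_vector_derivative ?c2 t) (at t within J)"
      "(?c2 has_vector_derivative ?c3 t) (at t within J)"
      using smooth_on_interval_has_deriv[OF smooth_on_interval_deriv[OF sm] t]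
        smooth_on_interval_has_deriv[OF smooth_on_interval_deriv[OF smooth_on_interval_deriv[OF sm]] t]
      by auto
    have "((\<lambda>t. ?c1 t $ 1 * ?c2 t $ 2 - ?c1 t $ 2 * ?c2 t $ 1) has_real_derivative
       ?c1 t $ 1 * ?c3 t $ 2 - ?c1 t $ 2 * ?c3 t $ 1) (at t within J)"
      by (rule derivative_eq_intros d[THEN has_real_derivative_vec_nth] refl | simp)+
    then have "deriv_on J (\<lambda>t. ?c1 t $ 1 * ?c2 t $ 2 - ?c1 t $ 2 * ?c2 t $ 1) t
        = ?c1 t $ 1 * ?c3 t $ 2 - ?c1 t $ 2 * ?c3 t $ 1"
      by (intro deriv_on_eqI[OF J t]) (simp add: has_real_derivative_iff_has_vector_derivative)
    moreover have "deriv_on J (\<lambda>t. ?c1 t $ 1 * ?c2 t $ 2 - ?c1 t $ 2 * ?c2 t $ 1) t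
        = deriv_on J (\<lambda>_. 1) t"
      by (rule deriv_on_cong) (use det1 t in auto)
    moreover have "deriv_on J (\<lambda>_. 1) t = (0::real)"
      by (rule deriv_on_eqI[OF J t]) simp
    ultimately show ?thesis by simp
  qed
  \<comment> \<open>Cramer's rule in the basis \<open>?c1 t\<close>, \<open>?c2 t\<close> of
    determinant 1.\<close>
  then have "?c3 t = - (?c2 t $ 1 * ?c3 t $ 2 - ?c2 t $ 2 * ?c3 t $ 1) *\<^sub>R ?c1 t"
    using det1[OF t] unfolding vec_eq_iff forall_2 by simp algebra
  then obtain \<kappa> where \<kappa>: "?c3 t = - \<kappa> *\<^sub>R ?c1 t" by blast
  then have uniq: "?c3 t = - \<kappa>' *\<^sub>R ?c1 t \<longleftrightarrow> \<kappa>' = \<kappa>" for \<kappa>'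
    using nz by auto
  have "equiaffine_curvature J c t = \<kappa>"
    unfolding equiaffine_curvature_def eq by (rule the_equality) (use uniq in auto)
  then show ?thesis using uniq by auto
qed

text \<open>The equation \<open>c''' = - k c'\<close> is the system of
  \<open>frenet_solution\<close> with \<open>V = c'\<close>, \<open>W = c''\<close> and the
  parameter itself as \<open>u\<close>.\<close>

lemma constant_curvature_solution:
  assumes c: "equiaffine_parametrized J c" and k: "\<And>t. t \<in> J \<Longrightarrow> equiaffine_curvature J c t = k"
    and t: "t0 \<in> J" "t \<in> J"
  shows "c t = c t0 + gsin k (t - t0) *\<^sub>R deriv_on J c t0
      + gver k (t - t0) *\<^sub>R deriv_on J (deriv_on J c) t0"
proof -
  have J: "nondegenerate_interval J" and sm: "smooth_on_interval J c"
    using c by (auto simp: equiaffine_parametrized_def curve_def)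
  show ?thesis
  proof (rule frenet_solution[OF nondegenerate_interval_convex[OF J] t, where u = "\<lambda>t. t" and u' = "\<lambda>_. 1"])
    fix t assume t: "t \<in> J"
    show "(c has_vector_derivative 1 *\<^sub>R deriv_on J c t) (at t within J)"
      using smooth_on_interval_has_deriv sm t by simp
    show "(deriv_on J c has_vector_derivative 1 *\<^sub>R deriv_on J (deriv_on J c) t) (at t within J)"
      using smooth_on_interval_has_deriv[OF smooth_on_interval_deriv[OF sm] t] by simp
    have "(deriv_on J (deriv_on J c) has_vector_derivative deriv_on J (deriv_on J (deriv_on J c)) t)
        (at t within J)"
      by (rule smooth_on_interval_has_deriv[OF smooth_on_interval_deriv[OF smooth_on_interval_deriv[OF sm]] t])
    also have "deriv_on J (deriv_on J (deriv_on J c)) t = - k *\<^sub>R deriv_on J c t"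
      using equiaffine_curvature_iff[OF c t] k[OF t] by blast
    finally show "(deriv_on J (deriv_on J c) has_vector_derivative - (k * 1) *\<^sub>R deriv_on J c t)
        (at t within J)" by simp
  qed (auto intro!: derivative_eq_intros)
qed

section \<open>Arcs in affine normal form\<close>

definition conic_arc :: "real set \<Rightarrow> (real \<Rightarrow> real^2) \<Rightarrow> bool" where
  "conic_arc I \<gamma> \<longleftrightarrow> (\<exists>k p e1 e2 u. det (col_matrix e1 e2) \<noteq> 0 \<and> smooth_on_interval I u \<and>
     (\<forall>s\<in>I. \<gamma> s = p + gsin k (u s) *\<^sub>R e1 + gver k (u s) *\<^sub>R e2))"

section \<open>From constant equiaffine curvature to the normal form\<close>

lemma reparametrize_image:
  assumes "reparametrization I \<phi>" "s \<in> I"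
  shows "reparametrize I \<phi> \<gamma> (\<phi> s) = \<gamma> s"
proof -
  have "inj_on \<phi> I"
    using assms(1) unfolding reparametrization_def homeomorphism_def by (metis inj_on_inverseI)
  then show ?thesis using assms(2) by (simp add: reparametrize_def the_inv_into_f_f)
qed

text \<open>The offset \<open>a\<close> and the second interval \<open>I'\<close> serve subcurves:
  \<gamma> on \<open>I\<close> may be a supercurve, and the base point \<open>s0\<close> may lie
  outside the arc. The case \<open>a = 0\<close>, \<open>I' = I\<close> treats the curve
  itself.\<close>

lemma equiaffine_parametrized_conic_arc:
  assumes \<phi>: "reparametrization I \<phi>"
    and c: "equiaffine_parametrized (\<phi> ` I) (reparametrize I \<phi> \<gamma>)"
    and k: "\<And>t. t \<in> \<phi> ` I \<Longrightarrow> equiaffine_curvature (\<phi> ` I) (reparametrize I \<phi> \<gamma>) t = k"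
    and I': "nondegenerate_interval I'" and sub: "(\<lambda>s. a + s) ` I' \<subseteq> I"
  shows "conic_arc I' (\<lambda>s. \<gamma> (a + s))"
proof -
  obtain s0 where s0: "s0 \<in> I" using I' sub unfolding nondegenerate_interval_def by blast
  let ?c = "reparametrize I \<phi> \<gamma>" and ?t0 = "\<phi> s0"
  let ?u = "\<lambda>s. \<phi> (a + s) - ?t0"
  have "smooth_on_interval I' (\<lambda>s. \<phi> (a + s))"
    using smooth_on_interval_shift[OF _ I' sub] \<phi> unfolding reparametrization_def by blast
  from smooth_on_interval_bounded_linear[OF I' this bounded_linear_ident, of "- ?t0"]
  have "smooth_on_interval I' ?u" by simp
  moreover have "det (col_matrix (deriv_on (\<phi> ` I) ?c ?t0) (deriv_on (\<phi> ` I) (deriv_on (\<phi> ` I) ?c) ?t0)) \<noteq> 0"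
    using c s0 by (auto simp: equiaffine_parametrized_def equiaffine_frame_def)
  moreover have "\<gamma> (a + s) = ?c ?t0 + gsin k (?u s) *\<^sub>R deriv_on (\<phi> ` I) ?c ?t0
      + gver k (?u s) *\<^sub>R deriv_on (\<phi> ` I) (deriv_on (\<phi> ` I) ?c) ?t0" if "s \<in> I'" for s
  proof -
    have s: "a + s \<in> I" using that sub by blast
    show ?thesis
      using constant_curvature_solution[OF c k, of ?t0 "\<phi> (a + s)"] s s0
      by (simp add: reparametrize_image[OF \<phi> s])
  qed
  ultimately show ?thesis unfolding conic_arc_def by blast
qed

lemma constant_equiaffine_curvature_imp_conic_arc:
  assumes "constant_equiaffine_curvature I \<gamma>" "nondegenerate_interval I"
  shows "conic_arc I \<gamma>"
  using assms equiaffine_parametrized_conic_arc[of I _ \<gamma> _ I 0]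
  unfolding constant_equiaffine_curvature_def equiaffine_parameter_def by auto

section \<open>Self-affinity forces constant curvature\<close>

text \<open>Derivatives relative to \<open>J\<close> restrict to \<open>K\<close>, where the chain
  rule differentiates both sides of \<open>eq\<close>; nondegeneracy of \<open>K\<close> makes the
  two results comparable.\<close>

lemma deriv_on_affine_shift:
  fixes c :: "real \<Rightarrow> real^2"
  assumes J: "smooth_on_interval J c" and K: "nondegenerate_interval K" "K \<subseteq> J" "(\<lambda>t. \<epsilon> + t) ` K \<subseteq> J"
    and eq: "\<And>t. t \<in> K \<Longrightarrow> c (\<epsilon> + t) = A *v c t + b" and t: "t \<in> K"
  shows "deriv_on J c (\<epsilon> + t) = A *v deriv_on J c t"
proof -
  have "((\<lambda>t. c (\<epsilon> + t)) has_vector_derivative deriv_on J c (\<epsilon> + t)) (at t within K)"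
    by (rule has_vector_derivative_shift[OF smooth_on_interval_has_deriv[OF J] K(3)]) (use K t in auto)
  moreover have "(c has_vector_derivative deriv_on J c t) (at t within K)"
    using K t by (blast intro: has_vector_derivative_within_subset smooth_on_interval_has_deriv[OF J])
  then have "((\<lambda>t. A *v c t + b) has_vector_derivative A *v deriv_on J c t + 0) (at t within K)"
    by (intro has_vector_derivative_add has_vector_derivative_const
        bounded_linear.has_vector_derivative[OF matrix_vector_mul_bounded_linear[of A]])
  moreover have "deriv_on K (\<lambda>t. c (\<epsilon> + t)) t = deriv_on K (\<lambda>t. A *v c t + b) t"
    by (rule deriv_on_cong) (use eq t in auto)
  ultimately show ?thesis
    by (simp add: deriv_on_eqI[OF K(1) t])
qed

lemma ESA_curvature_constant:
  assumes c: "equiaffine_parametrized J c"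
    and F: "\<And>t \<epsilon>. t \<in> J \<Longrightarrow> t + \<epsilon> \<in> J \<Longrightarrow> c (t + \<epsilon>) = aff_apply (F \<epsilon>) (c t)"
    and t: "t \<in> J" "t' \<in> J" "t < t'"
  shows "equiaffine_curvature J c t = equiaffine_curvature J c t'"
proof -
  let ?c1 = "deriv_on J c" and ?c3 = "deriv_on J (deriv_on J (deriv_on J c))"
  let ?\<kappa> = "equiaffine_curvature J c"
  have J: "nondegenerate_interval J" and sm: "smooth_on_interval J c" and nz: "\<And>t. t \<in> J \<Longrightarrow> ?c1 t \<noteq> 0"
    using c unfolding equiaffine_parametrized_def curve_def by blast+
  text \<open>Passing through the midpoint \<open>m\<close> keeps both shifts inside a nondegenerate interval \<open>K\<close>,
    even when \<open>t\<close> and \<open>t'\<close> are the end points of \<open>J\<close>.\<close>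
  define m where "m = (t + t') / 2"
  define \<epsilon> where "\<epsilon> = (t' - t) / 2"
  define K where "K = {t..m}"
  have m: "\<epsilon> + t = m" "\<epsilon> + m = t'" unfolding m_def \<epsilon>_def by argo+
  have "{t..t'} \<subseteq> J"
    using J t mem_is_interval_1_I[of J t t'] unfolding nondegenerate_interval_def by auto
  moreover have "t < m" and "m < t'" and "0 < \<epsilon>" using t unfolding m_def \<epsilon>_def by argo+
  moreover have "\<epsilon> + r \<in> {t..t'}" if "r \<in> {t..m}" for r
    using that \<open>0 < \<epsilon>\<close> unfolding m(2)[symmetric] by simp
  moreover have "{t..m} \<subseteq> {t..t'}" using \<open>m < t'\<close> by auto
  ultimately have K: "nondegenerate_interval K" "K \<subseteq> J" "(\<lambda>t. \<epsilon> + t) ` K \<subseteq> J"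
    unfolding K_def image_subset_iff using nondegenerate_interval_Icc by blast+
  obtain A b where Ab: "F \<epsilon> = (A, b)" by (cases "F \<epsilon>")
  have 0: "c (\<epsilon> + r) = A *v c r + b" if "r \<in> K" for r
    using F[of r \<epsilon>] subsetD[OF K(2) that] subsetD[OF K(3) imageI[OF that]]
    by (simp add: Ab aff_apply_def add.commute)
  note d = smooth_on_interval_deriv
  have 1: "?c1 (\<epsilon> + r) = A *v ?c1 r" if "r \<in> K" for r
    using deriv_on_affine_shift[OF sm K 0 that] .
  \<comment> \<open>From the first derivative on the translation has disappeared, hence
    \<open>b = 0\<close>.\<close>
  have 2: "deriv_on J ?c1 (\<epsilon> + r) = A *v deriv_on J ?c1 r" if "r \<in> K" for r
    by (rule deriv_on_affine_shift[OF d[OF sm] K _ that, where b = 0]) (simp add: 1)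
  have 3: "?c3 (\<epsilon> + r) = A *v ?c3 r" if "r \<in> K" for r
    by (rule deriv_on_affine_shift[OF d[OF d[OF sm]] K _ that, where b = 0]) (simp add: 2)
  have *: "?\<kappa> r = ?\<kappa> (\<epsilon> + r)" if "r \<in> K" for r
  proof -
    have r: "r \<in> J" "\<epsilon> + r \<in> J" using K that by auto
    have "?c3 (\<epsilon> + r) = A *v (- ?\<kappa> r *\<^sub>R ?c1 r)"
      using 3[OF that] equiaffine_curvature_iff[OF c r(1)] by metis
    also have "\<dots> = - ?\<kappa> r *\<^sub>R ?c1 (\<epsilon> + r)"
      by (simp only: 1[OF that] matrix_vector_mult_scaleR)
    finally show ?thesis using equiaffine_curvature_iff[OF c r(2)] by metis
  qed
  \<comment> \<open>Two shifts by \<epsilon> lead from \<open>t\<close> to \<open>m\<close> and from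
    \<open>m\<close> to \<open>t'\<close>; both starting points lie in \<open>K\<close>.\<close>
  have "t \<in> K" "m \<in> K" using t by (auto simp: K_def m_def)
  from *[OF this(1)] *[OF this(2)] show ?thesis by (simp add: m)
qed

text \<open>The self-affinity lives on the supercurve, so constancy of the curvature is proved
  there, by comparison with the value at \<open>\<phi> 0\<close>; the normal form is then restricted
  to the subcurve, which starts at \<open>s0\<close>.\<close>

lemma ESA_imp_conic_arc:
  assumes "possesses_ESA equiaffine_parameter equiaffine_group l \<gamma>" "l > 0"
  shows "conic_arc {0..l} \<gamma>"
proof -
  from assms(1) obtain l' \<gamma>' \<phi> F where sup: "supercurve l' \<gamma>' l \<gamma>"
    and \<phi>: "equiaffine_parameter {0..l'} \<gamma>' \<phi>"
    and F': "\<forall>t \<epsilon>. t \<in> \<phi> ` {0..l'} \<and> t + \<epsilon> \<in> \<phi> ` {0..l'} \<longrightarrow>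
           reparametrize {0..l'} \<phi> \<gamma>' (t + \<epsilon>)
             = aff_apply (F \<epsilon>) (reparametrize {0..l'} \<phi> \<gamma>' t)"
    unfolding possesses_ESA_def by (elim exE conjE) (rule that)
  obtain s0 where s0: "s0 \<ge> 0" "s0 + l \<le> l'" "\<And>s. s \<in> {0..l} \<Longrightarrow> \<gamma> s = \<gamma>' (s0 + s)"
    using sup unfolding supercurve_def by blast
  let ?J = "\<phi> ` {0..l'}" and ?c = "reparametrize {0..l'} \<phi> \<gamma>'"
  have F: "?c (t + \<epsilon>) = aff_apply (F \<epsilon>) (?c t)" if "t \<in> ?J" "t + \<epsilon> \<in> ?J" for t \<epsilon>
    using F'[rule_format, OF conjI[OF that]] .
  have \<phi>: "reparametrization {0..l'} \<phi>" and c: "equiaffine_parametrized ?J ?c"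
    using \<phi> by (auto simp: equiaffine_parameter_def)
  have const: "equiaffine_curvature ?J ?c t = equiaffine_curvature ?J ?c (\<phi> 0)" if "t \<in> ?J" for t
  proof -
    have 0: "\<phi> 0 \<in> ?J" using s0 assms(2) by auto
    consider "t < \<phi> 0" | "t = \<phi> 0" | "\<phi> 0 < t" by linarith
    then show ?thesis
    proof cases
      case 1
      show ?thesis by (rule ESA_curvature_constant[OF c F that 0 1])
    next
      case 3
      show ?thesis by (rule ESA_curvature_constant[OF c F 0 that 3, symmetric])
    qed simp
  qed
  have "conic_arc {0..l} (\<lambda>s. \<gamma>' (s0 + s))"
    by (rule equiaffine_parametrized_conic_arc[OF \<phi> c const nondegenerate_interval_Icc[OF assms(2)]])
      (use s0 in auto)
  then show ?thesis unfolding conic_arc_def using s0(3) by simp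
qed

section \<open>From the normal form back to constant curvature and to self-affinity\<close>

lemma has_vector_derivative_combination:
  assumes "(a has_real_derivative a') (at t within I)" "(b has_real_derivative b') (at t within I)"
  shows "((\<lambda>t. p + a t *\<^sub>R x + b t *\<^sub>R y) has_vector_derivative a' *\<^sub>R x + b' *\<^sub>R y) (at t within I)"
proof -
  have "((\<lambda>t. a t *\<^sub>R x) has_vector_derivative a' *\<^sub>R x) (at t within I)"
    "((\<lambda>t. b t *\<^sub>R y) has_vector_derivative b' *\<^sub>R y) (at t within I)"
    using assms[THEN has_vector_derivative_scaleR, OF has_vector_derivative_const] by auto
  from has_vector_derivative_add[OF has_vector_derivative_add[OF has_vector_derivative_const this(1)] this(2)]
  show ?thesis by simp
qed

text \<open>The factor \<open>1 - k * gver k\<close> is expanded so that the derivative has the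
  shape of the original with other vectors. This gives smoothness by coinduction and all higher
  derivatives by iteration.\<close>

lemma conic_param_has_derivative:
  fixes p e1 e2 :: "'a::real_normed_vector"
  shows "((\<lambda>t. p + gsin k (\<omega> * t) *\<^sub>R e1 + gver k (\<omega> * t) *\<^sub>R e2) has_vector_derivative
    \<omega> *\<^sub>R e1 + gsin k (\<omega> * t) *\<^sub>R (\<omega> *\<^sub>R e2) + gver k (\<omega> * t) *\<^sub>R (- (k * \<omega>) *\<^sub>R e1)) (at t within I)"
proof -
  have "((\<lambda>t. gsin k (\<omega> * t)) has_real_derivative (1 - k * gver k (\<omega> * t)) * \<omega>) (at t within I)"
    "((\<lambda>t. gver k (\<omega> * t)) has_real_derivative gsin k (\<omega> * t) * \<omega>) (at t within I)"
    by (auto intro!: derivative_eq_intros)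
  from has_vector_derivative_combination[OF this, of p e1 e2]
  show ?thesis by (simp add: algebra_simps)
qed

lemma smooth_on_interval_conic_param:
  assumes I: "nondegenerate_interval I"
  shows "smooth_on_interval I (\<lambda>t. p + gsin k (\<omega> * t) *\<^sub>R e1 + gver k (\<omega> * t) *\<^sub>R e2)"
  by (rule smooth_on_interval_coinduct[OF I,
      where P = "\<lambda>f. \<exists>p e1 e2. f = (\<lambda>t. p + gsin k (\<omega> * t) *\<^sub>R e1 + gver k (\<omega> * t) *\<^sub>R e2)"])
    (use conic_param_has_derivative in blast)+

lemma smooth_on_interval_cong:
  assumes I: "nondegenerate_interval I" and f: "smooth_on_interval I f"
    and eq: "\<And>t. t \<in> I \<Longrightarrow> g t = f t"
  shows "smooth_on_interval I g"
  by (rule smooth_on_interval_antiderivative[OF I smooth_on_interval_deriv[OF f]])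
    (metis eq f has_vector_derivative_transform smooth_on_interval_has_deriv)

text \<open>Rolle's theorem gives injectivity, and a continuous injection on a compact interval is a
  homeomorphism onto its image.\<close>

lemma reparametrization_of_nonzero_derivative:
  assumes l: "0 < l" and u: "smooth_on_interval {0..l} \<phi>"
    and nz: "\<And>s. s \<in> {0..l} \<Longrightarrow> deriv_on {0..l} \<phi> s \<noteq> 0"
  shows "reparametrization {0..l} \<phi>" and "nondegenerate_interval (\<phi> ` {0..l})"
proof -
  have d: "(\<phi> has_real_derivative deriv_on {0..l} \<phi> s) (at s within {0..l})" if "s \<in> {0..l}" for s
    using smooth_on_interval_has_deriv[OF u that]
    by (simp add: has_real_derivative_iff_has_vector_derivative)
  have cont: "continuous_on {0..l} \<phi>"
    using d by (meson DERIV_continuous_on)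
  have neq: "\<phi> a \<noteq> \<phi> b" if ab: "a < b" "a \<in> {0..l}" "b \<in> {0..l}" for a b
  proof
    assume eq: "\<phi> a = \<phi> b"
    have d': "(\<phi> has_real_derivative deriv_on {0..l} \<phi> x) (at x)" if "a < x" "x < b" for x
      using d[of x] at_within_Icc_at[of 0 x l] that ab by auto
    have "continuous_on {a..b} \<phi>"
      using cont ab by (auto intro: continuous_on_subset)
    then obtain z where z: "a < z" "z < b" "DERIV \<phi> z :> 0"
      using Rolle[OF ab(1) eq] d' by (metis real_differentiable_def)
    then show False using DERIV_unique[OF d'[OF z(1,2)] z(3)] nz[of z] ab by auto
  qed
  have inj: "inj_on \<phi> {0..l}"
    by (rule inj_onI) (metis neq linorder_neqE_linordered_idom)
  then have "\<exists>\<psi>. homeomorphism {0..l} (\<phi> ` {0..l}) \<phi> \<psi>"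
    using homeomorphism_compact[OF compact_Icc cont refl] by blast
  with u show "reparametrization {0..l} \<phi>" by (simp add: reparametrization_def)
  have "is_interval (\<phi> ` {0..l})"
    unfolding is_interval_connected_1 by (rule connected_continuous_image[OF cont]) simp
  moreover have "\<phi> 0 \<in> \<phi> ` {0..l}" "\<phi> l \<in> \<phi> ` {0..l}" "\<phi> 0 \<noteq> \<phi> l"
    using l neq[of 0 l] by auto
  ultimately show "nondegenerate_interval (\<phi> ` {0..l})"
    unfolding nondegenerate_interval_def by (metis linorder_neqE_linordered_idom)
qed

text \<open>\<open>c'\<close> contributes one factor \<omega> and \<open>c''\<close> two, so the
  frame determinant is \<open>\<omega> ^ 3 * det (col_matrix e1 e2)\<close> times the Pythagorean
  sum 1. A third differentiation returns \<open>- k * \<omega>\<^sup>2\<close> times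
  \<open>c'\<close>.\<close>

lemma equiaffine_parametrized_conic_param:
  fixes p e1 e2 :: "real^2"
  assumes J: "nondegenerate_interval J"
    and c: "\<And>t. t \<in> J \<Longrightarrow> c t = p + gsin k (\<omega> * t) *\<^sub>R e1 + gver k (\<omega> * t) *\<^sub>R e2"
    and \<omega>: "\<omega> ^ 3 * det (col_matrix e1 e2) = 1"
  shows "equiaffine_parametrized J c"
    and "t \<in> J \<Longrightarrow> equiaffine_curvature J c t = k * \<omega>\<^sup>2"
proof -
  define h where "h p e1 e2 t = p + gsin k (\<omega> * t) *\<^sub>R e1 + gver k (\<omega> * t) *\<^sub>R e2"
    for p e1 e2 :: "real^2" and t
  have dh: "deriv_on J f t = h (\<omega> *\<^sub>R e1) (\<omega> *\<^sub>R e2) (- (k * \<omega>) *\<^sub>R e1) t"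
    if "\<And>t. t \<in> J \<Longrightarrow> f t = h p e1 e2 t" "t \<in> J" for f p e1 e2 t
  proof -
    have "deriv_on J f t = deriv_on J (h p e1 e2) t"
      by (rule deriv_on_cong) (use that in auto)
    also have "\<dots> = h (\<omega> *\<^sub>R e1) (\<omega> *\<^sub>R e2) (- (k * \<omega>) *\<^sub>R e1) t"
      using deriv_on_eqI[OF J that(2) conic_param_has_derivative[of p k \<omega> e1 e2]]
      unfolding h_def by blast
    finally show ?thesis .
  qed
  have c0: "c t = h p e1 e2 t" if "t \<in> J" for t using c[OF that] by (simp add: h_def)
  \<comment> \<open>Each derivative is again an \<open>h\<close> on \<open>J\<close>, so
    \<open>dh\<close> applies to its own result.\<close>
  note c1 = dh[OF c0, simplified]
  note c2 = dh[OF c1, simplified]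
  note c3 = dh[OF c2, simplified]
  have det1: "det (equiaffine_frame J c t) = 1" if t: "t \<in> J" for t
  proof -
    let ?S = "gsin k (\<omega> * t)" and ?C = "1 - k * gver k (\<omega> * t)"
    have "deriv_on J c t = \<omega> *\<^sub>R (?C *\<^sub>R e1 + ?S *\<^sub>R e2)"
      unfolding c1[OF t] h_def by (simp add: algebra_simps)
    moreover have "deriv_on J (deriv_on J c) t = \<omega>\<^sup>2 *\<^sub>R (?C *\<^sub>R e2 - (k * ?S) *\<^sub>R e1)"
      unfolding c2[OF t] h_def by (simp add: algebra_simps power2_eq_square)
    ultimately have "det (equiaffine_frame J c t)
      = det (col_matrix ((\<omega> * ?C) *\<^sub>R e1 + (\<omega> * ?S) *\<^sub>R e2) ((- \<omega>\<^sup>2 * k * ?S) *\<^sub>R e1 + (\<omega>\<^sup>2 * ?C) *\<^sub>R e2))"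
      unfolding equiaffine_frame_def by (simp add: scaleR_add_right scaleR_diff_right mult.assoc)
    also have "\<dots> = \<omega> ^ 3 * det (col_matrix e1 e2) * (?C\<^sup>2 + k * ?S\<^sup>2)"
      unfolding det_col_matrix_combination power2_eq_square power3_eq_cube by algebra
    finally have "det (equiaffine_frame J c t) = \<omega> ^ 3 * det (col_matrix e1 e2) * (?C\<^sup>2 + k * ?S\<^sup>2)" .
    then show ?thesis unfolding gsin_gver_pythagoras \<omega> by simp
  qed
  have "smooth_on_interval J c"
    by (rule smooth_on_interval_cong[OF J smooth_on_interval_conic_param[OF J] c])
  moreover have "deriv_on J c t \<noteq> 0" if "t \<in> J" for t
    using det1[OF that] unfolding equiaffine_frame_def det_col_matrix by auto
  ultimately show ep: "equiaffine_parametrized J c"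
    using J det1 by (auto simp: equiaffine_parametrized_def curve_def)
  show "equiaffine_curvature J c t = k * \<omega>\<^sup>2" if t: "t \<in> J"
    unfolding equiaffine_curvature_iff[OF ep t] c3[OF t] c1[OF t] h_def
    by (simp add: algebra_simps power2_eq_square)
qed

lemma conic_arc_imp_constant_equiaffine_curvature:
  assumes \<gamma>: "curve {0..l} \<gamma>" and l: "0 < l" and "conic_arc {0..l} \<gamma>"
  shows "constant_equiaffine_curvature {0..l} \<gamma>"
proof -
  from assms(3) obtain k p e1 e2 u where D: "det (col_matrix e1 e2) \<noteq> 0"
    and u: "smooth_on_interval {0..l} u"
    and eq: "\<And>s. s \<in> {0..l} \<Longrightarrow> \<gamma> s = p + gsin k (u s) *\<^sub>R e1 + gver k (u s) *\<^sub>R e2"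
    unfolding conic_arc_def by blast
  \<comment> \<open>Chosen to normalize the frame determinant of the rescaled parameter
    \<open>u s / \<omega>\<close> to 1. The real cube root exists for both signs; a negative
    determinant reverses the direction of the parameter.\<close>
  define \<omega> where "\<omega> = root 3 (1 / det (col_matrix e1 e2))"
  have \<omega>: "\<omega> ^ 3 * det (col_matrix e1 e2) = 1"
    using D unfolding \<omega>_def by (subst odd_real_root_pow) auto
  then have \<omega>0: "\<omega> \<noteq> 0" by auto
  define \<phi> where "\<phi> s = u s / \<omega>" for s
  let ?I = "{0..l}"
  have I: "nondegenerate_interval ?I" by (rule nondegenerate_interval_Icc[OF l])
  have sm: "smooth_on_interval ?I \<phi>"
    using smooth_on_interval_bounded_linear[OF I u bounded_linear_mult_left[of "1 / \<omega>"], of 0]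
    unfolding \<phi>_def by simp
  have eq': "\<gamma> s = p + gsin k (\<omega> * \<phi> s) *\<^sub>R e1 + gver k (\<omega> * \<phi> s) *\<^sub>R e2" if "s \<in> ?I" for s
    using eq[OF that] \<omega>0 by (simp add: \<phi>_def)
  \<comment> \<open>A critical point of \<phi> would, by the chain rule, be a zero of the derivative
    of the regular curve \<gamma>.\<close>
  have nz: "deriv_on ?I \<phi> s \<noteq> 0" if s: "s \<in> ?I" for s
  proof
    assume z: "deriv_on ?I \<phi> s = 0"
    let ?h = "\<lambda>t. p + gsin k (\<omega> * t) *\<^sub>R e1 + gver k (\<omega> * t) *\<^sub>R e2"
    have "((?h \<circ> \<phi>) has_vector_derivative 0) (at s within ?I)"
      using vector_diff_chain_within[OF smooth_on_interval_has_deriv[OF sm s] conic_param_has_derivative]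
      unfolding z by simp
    then have "deriv_on ?I (?h \<circ> \<phi>) s = 0"
      by (rule deriv_on_eqI[OF I s])
    moreover have "deriv_on ?I \<gamma> s = deriv_on ?I (?h \<circ> \<phi>) s"
      by (rule deriv_on_cong) (use eq' s in auto)
    ultimately show False using \<gamma> s by (auto simp: curve_def)
  qed
  note rep = reparametrization_of_nonzero_derivative[OF l sm nz]
  have "reparametrize ?I \<phi> \<gamma> t = p + gsin k (\<omega> * t) *\<^sub>R e1 + gver k (\<omega> * t) *\<^sub>R e2"
    if "t \<in> \<phi> ` ?I" for t
    using that eq' reparametrize_image[OF rep(1)] by auto
  from equiaffine_parametrized_conic_param[OF rep(2) this \<omega>]
  show ?thesis
    using rep(1) unfolding constant_equiaffine_curvature_def equiaffine_parameter_def by blast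
qed

text \<open>The linear part of \<open>F \<epsilon>\<close> moves \<open>e1\<close> and \<open>e2\<close> to the first two derivatives \<open>V\<close> and \<open>W\<close>
  of the arc at parameter \<open>\<epsilon>\<close>.\<close>

lemma equiaffine_motion_exists:
  fixes p e1 e2 :: "real^2"
  assumes D: "det (col_matrix e1 e2) \<noteq> 0"
  obtains F where "\<And>\<epsilon>. F \<epsilon> \<in> equiaffine_group" "F differentiable_on UNIV"
    "\<And>t \<epsilon>. p + gsin k (t + \<epsilon>) *\<^sub>R e1 + gver k (t + \<epsilon>) *\<^sub>R e2
       = aff_apply (F \<epsilon>) (p + gsin k t *\<^sub>R e1 + gver k t *\<^sub>R e2)"
proof -
  define C where "C t = 1 - k * gver k t" for t
  define c where "c t = p + gsin k t *\<^sub>R e1 + gver k t *\<^sub>R e2" for t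
  define V where "V t = C t *\<^sub>R e1 + gsin k t *\<^sub>R e2" for t
  define W where "W t = C t *\<^sub>R e2 - (k * gsin k t) *\<^sub>R e1" for t
  obtain E where E: "E ** col_matrix e1 e2 = mat 1"
    using D invertible_det_nz invertible_left_inverse by blast
  \<comment> \<open>The translation part makes \<open>p = c 0\<close> go to
    \<open>c \<epsilon>\<close>.\<close>
  define F where "F \<epsilon> = (col_matrix (V \<epsilon>) (W \<epsilon>) ** E, c \<epsilon> - (col_matrix (V \<epsilon>) (W \<epsilon>) ** E) *v p)" for \<epsilon>
  have S: "(gsin k has_real_derivative C t) (at t)" for t
    using DERIV_gsin by (simp add: C_def)
  have C: "(C has_real_derivative - (k * gsin k t)) (at t)" for t
    unfolding C_def using DERIV_gver[of k t] by (auto intro!: derivative_eq_intros)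
  have c': "(c has_vector_derivative V t) (at t)" for t
    unfolding c_def V_def
    by (rule has_vector_derivative_combination[OF S DERIV_gver])
  have V': "(V has_vector_derivative W t) (at t)" for t
    unfolding V_def W_def
    using has_vector_derivative_combination[OF C S, of 0 e1 e2] by simp
  have W': "(W has_vector_derivative - k *\<^sub>R V t) (at t)" for t
    unfolding V_def W_def
    using has_vector_derivative_combination[OF C DERIV_cmult[OF S, of "- k"], of 0 e2 e1]
    by (simp add: algebra_simps)
  \<comment> \<open>An addition theorem: expanded about \<epsilon> instead of 0, the arc has the
    same coefficient functions of \<open>t\<close>, with the moved frame
    \<open>V \<epsilon>\<close>, \<open>W \<epsilon>\<close>.\<close>
  have c_add: "c (t + \<epsilon>) = c \<epsilon> + gsin k t *\<^sub>R V \<epsilon> + gver k t *\<^sub>R W \<epsilon>" for t \<epsilon>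
    using frenet_solution[of UNIV \<epsilon> "t + \<epsilon>" "\<lambda>t. t" "\<lambda>_. 1" c V W k] c' V' W' by simp
  have e: "(col_matrix (V \<epsilon>) (W \<epsilon>) ** E) *v e1 = V \<epsilon>" "(col_matrix (V \<epsilon>) (W \<epsilon>) ** E) *v e2 = W \<epsilon>" for \<epsilon>
  proof -
    have "(col_matrix (V \<epsilon>) (W \<epsilon>) ** E) ** col_matrix e1 e2 = col_matrix (V \<epsilon>) (W \<epsilon>)"
      by (simp add: E flip: matrix_mul_assoc)
    then show "(col_matrix (V \<epsilon>) (W \<epsilon>) ** E) *v e1 = V \<epsilon>" "(col_matrix (V \<epsilon>) (W \<epsilon>) ** E) *v e2 = W \<epsilon>"
      unfolding matrix_mult_col_matrix col_matrix_eq_iff by auto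
  qed
  show thesis
  proof
    fix \<epsilon>
    \<comment> \<open>The moving frame keeps the determinant of \<open>e1\<close>,
      \<open>e2\<close>, which multiplication by the inverse \<open>E\<close> cancels.\<close>
    have "det (col_matrix (V \<epsilon>) (W \<epsilon>)) = det (col_matrix (C \<epsilon> *\<^sub>R e1 + gsin k \<epsilon> *\<^sub>R e2)
        (- (k * gsin k \<epsilon>) *\<^sub>R e1 + C \<epsilon> *\<^sub>R e2))"
      by (simp add: V_def W_def)
    also have "\<dots> = ((C \<epsilon>)\<^sup>2 + k * (gsin k \<epsilon>)\<^sup>2) * det (col_matrix e1 e2)"
      unfolding det_col_matrix_combination power2_eq_square by algebra
    also have "\<dots> = det (col_matrix e1 e2)"
      unfolding C_def gsin_gver_pythagoras by simp
    finally have "det (col_matrix (V \<epsilon>) (W \<epsilon>)) * det E = 1"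
      using arg_cong[OF E, of det] by (simp add: det_mul mult.commute)
    then show "F \<epsilon> \<in> equiaffine_group"
      by (simp add: F_def equiaffine_group_def det_mul mult.commute)
  next
    let ?A = "\<lambda>t. col_matrix (V t) (W t) ** E"
    have lin: "linear (\<lambda>M::real^2^2. M ** E)"
      by (rule linearI) (simp_all add: matrix_matrix_mult_def vec_eq_iff sum.distrib sum_distrib_left algebra_simps)
    have A': "(?A has_vector_derivative col_matrix (W t) (- k *\<^sub>R V t) ** E) (at t)" for t
      using bounded_linear.has_vector_derivative[OF lin[unfolded linear_conv_bounded_linear]
          has_vector_derivative_col_matrix[OF V' W']] by simp
    have linp: "linear (\<lambda>M::real^2^2. M *v p)"
      by (rule linearI) (simp_all add: matrix_vector_mult_add_rdistrib scaleR_matrix_vector_assoc)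
    have "(F has_vector_derivative (col_matrix (W t) (- k *\<^sub>R V t) ** E,
        V t - (col_matrix (W t) (- k *\<^sub>R V t) ** E) *v p)) (at t)" for t
      unfolding F_def
      using has_vector_derivative_Pair[OF A' has_vector_derivative_diff[OF c'
            bounded_linear.has_vector_derivative[OF linp[unfolded linear_conv_bounded_linear] A']]]
      by simp
    then show "F differentiable_on UNIV"
      unfolding differentiable_on_def by (auto intro: differentiableI_vector)
  next
    fix t \<epsilon>
    have "aff_apply (F \<epsilon>) (c t) = c (t + \<epsilon>)"
      unfolding c_add
      by (simp add: F_def aff_apply_def c_def[of t] matrix_vector_right_distrib
          matrix_vector_mult_scaleR e)
    then show "p + gsin k (t + \<epsilon>) *\<^sub>R e1 + gver k (t + \<epsilon>) *\<^sub>R e2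
       = aff_apply (F \<epsilon>) (p + gsin k t *\<^sub>R e1 + gver k t *\<^sub>R e2)"
      by (simp add: c_def)
  qed
qed

text \<open>The curve serves as its own supercurve. Expanded about \<open>t0\<close>, it is a piece
  of the solution defined for all real parameters, and the motions of that solution restrict to
  it.\<close>

lemma constant_equiaffine_curvature_imp_ESA:
  assumes \<gamma>: "arc_length_curve l \<gamma>" and "constant_equiaffine_curvature {0..l} \<gamma>"
  shows "possesses_ESA equiaffine_parameter equiaffine_group l \<gamma>"
proof -
  let ?I = "{0..l}"
  from assms(2) obtain \<phi> k where par: "equiaffine_parameter ?I \<gamma> \<phi>"
    and k: "\<And>t. t \<in> \<phi> ` ?I \<Longrightarrow> equiaffine_curvature (\<phi> ` ?I) (reparametrize ?I \<phi> \<gamma>) t = k"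
    unfolding constant_equiaffine_curvature_def by blast
  let ?J = "\<phi> ` ?I" and ?c = "reparametrize ?I \<phi> \<gamma>"
  have c: "equiaffine_parametrized ?J ?c" and \<phi>: "reparametrization ?I \<phi>"
    using par by (auto simp: equiaffine_parameter_def)
  define t0 where "t0 = \<phi> 0"
  have t0: "t0 \<in> ?J" using \<gamma> by (simp add: t0_def arc_length_curve_def)
  let ?e1 = "deriv_on ?J ?c t0" and ?e2 = "deriv_on ?J (deriv_on ?J ?c) t0"
  have "det (col_matrix ?e1 ?e2) \<noteq> 0"
    using c t0 by (auto simp: equiaffine_parametrized_def equiaffine_frame_def)
  then obtain F where F: "\<And>\<epsilon>. F \<epsilon> \<in> equiaffine_group" "F differentiable_on UNIV"
    "\<And>t \<epsilon>. ?c t0 + gsin k (t + \<epsilon>) *\<^sub>R ?e1 + gver k (t + \<epsilon>) *\<^sub>R ?e2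
       = aff_apply (F \<epsilon>) (?c t0 + gsin k t *\<^sub>R ?e1 + gver k t *\<^sub>R ?e2)"
    by (rule equiaffine_motion_exists) blast
  have "?c (t + \<epsilon>) = aff_apply (F \<epsilon>) (?c t)" if "t \<in> ?J" "t + \<epsilon> \<in> ?J" for t \<epsilon>
    using constant_curvature_solution[OF c k t0 that(1)] constant_curvature_solution[OF c k t0 that(2)]
      F(3)[of "t - t0" \<epsilon>] by (simp add: algebra_simps)
  then have "\<forall>t \<epsilon>. t \<in> ?J \<and> t + \<epsilon> \<in> ?J \<longrightarrow> ?c (t + \<epsilon>) = aff_apply (F \<epsilon>) (?c t)"
    by simp
  moreover have "supercurve l \<gamma> l \<gamma>"
    unfolding supercurve_def using \<gamma> by (auto intro!: exI[of _ 0])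
  ultimately show ?thesis
    unfolding possesses_ESA_def using \<phi> par F(2) allI[OF F(1)]
    by (intro exI[of _ l] exI[of _ \<gamma>] exI[of _ \<phi>] exI[of _ F] conjI)
qed

section \<open>Conics\<close>

lemma orthogonal_matrix_col_matrix:
  assumes "\<alpha>\<^sup>2 + \<beta>\<^sup>2 = 1"
  shows "orthogonal_matrix (col_matrix (vector [\<alpha>, \<beta>]) (vector [- \<beta>, \<alpha>]))"
  using assms
  by (simp add: orthogonal_matrix col_matrix_def transpose_def matrix_matrix_mult_def mat_def
      vec_eq_iff forall_2 sum_2 power2_eq_square algebra_simps)

text \<open>The displayed vector consists of the coordinates of \<open>z\<close> with origin
  \<open>c\<close> and orthonormal axes \<open>(\<alpha>, \<beta>)\<close> and
  \<open>(- \<beta>, \<alpha>)\<close>, so congruence becomes a computation with equations.\<close>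

lemma congruent_sets_rotation:
  fixes c :: "real^2"
  assumes ab: "\<alpha>\<^sup>2 + \<beta>\<^sup>2 = 1"
    and T: "\<And>z. z \<in> S \<longleftrightarrow> vector [\<alpha> * (z$1 - c$1) + \<beta> * (z$2 - c$2), - \<beta> * (z$1 - c$1) + \<alpha> * (z$2 - c$2)] \<in> T"
  shows "congruent_sets S T"
proof -
  let ?R = "col_matrix (vector [\<alpha>, \<beta>]) (vector [- \<beta>, \<alpha>])"
  let ?g = "\<lambda>z. vector [\<alpha> * (z$1 - c$1) + \<beta> * (z$2 - c$2), - \<beta> * (z$1 - c$1) + \<alpha> * (z$2 - c$2)] :: real^2"
  have ab': "\<alpha> * \<alpha> + \<beta> * \<beta> = 1" using ab by (simp add: power2_eq_square)
  have 1: "?R *v ?g z + c = z" for z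
  proof -
    have "\<alpha> * (\<alpha> * X + \<beta> * Y) - \<beta> * (- \<beta> * X + \<alpha> * Y) = (\<alpha> * \<alpha> + \<beta> * \<beta>) * X"
      "\<beta> * (\<alpha> * X + \<beta> * Y) + \<alpha> * (- \<beta> * X + \<alpha> * Y) = (\<alpha> * \<alpha> + \<beta> * \<beta>) * Y" for X Y
      by (simp_all add: algebra_simps)
    from this[of "z$1 - c$1" "z$2 - c$2"] show ?thesis
      unfolding ab' by (simp add: col_matrix_mult vec_eq_iff forall_2 mult.commute)
  qed
  have 2: "?g (?R *v w + c) = w" for w
  proof -
    have "\<alpha> * (\<alpha> * X - \<beta> * Y) + \<beta> * (\<beta> * X + \<alpha> * Y) = (\<alpha> * \<alpha> + \<beta> * \<beta>) * X"
      "- \<beta> * (\<alpha> * X - \<beta> * Y) + \<alpha> * (\<beta> * X + \<alpha> * Y) = (\<alpha> * \<alpha> + \<beta> * \<beta>) * Y" for X Y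
      by (simp_all add: algebra_simps)
    from this[of "w$1" "w$2"] show ?thesis
      unfolding ab' by (simp add: col_matrix_mult vec_eq_iff forall_2 mult.commute)
  qed
  have "S = (\<lambda>z. ?R *v z + c) ` T"
  proof (rule set_eqI)
    fix z show "z \<in> S \<longleftrightarrow> z \<in> (\<lambda>z. ?R *v z + c) ` T"
    proof
      assume "z \<in> S"
      then have "?g z \<in> T" using T by blast
      then show "z \<in> (\<lambda>z. ?R *v z + c) ` T" using 1[of z] by (intro image_eqI[of _ _ "?g z"]) simp_all
    next
      assume "z \<in> (\<lambda>z. ?R *v z + c) ` T"
      then obtain w where "w \<in> T" "z = ?R *v w + c" by blast
      then show "z \<in> S" unfolding T using 2[of w] by simp
    qed
  qed
  then show ?thesis unfolding congruent_sets_def using orthogonal_matrix_col_matrix[OF ab] by blast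
qed

text \<open>The eigenvalues are \<open>(A + E) / 2 + r\<close> and \<open>(A + E) / 2 - r\<close>;
  the rotation angle is half the polar angle of the vector \<open>((A - E) / 2, B)\<close>, by the
  double-angle formulas.\<close>

lemma quadratic_form_diagonalization:
  fixes A B E :: real
  obtains \<alpha> \<beta> \<nu> \<mu> where "\<alpha>\<^sup>2 + \<beta>\<^sup>2 = 1" "\<mu> \<le> \<nu>" "\<nu> * \<mu> = A * E - B\<^sup>2"
    "\<And>X Y. A * X\<^sup>2 + 2 * B * X * Y + E * Y\<^sup>2 = \<nu> * (\<alpha> * X + \<beta> * Y)\<^sup>2 + \<mu> * (- \<beta> * X + \<alpha> * Y)\<^sup>2"
proof -
  define r where "r = sqrt (((A - E) / 2)\<^sup>2 + B\<^sup>2)"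
  have r0: "r \<ge> 0" and r2: "r\<^sup>2 = ((A - E) / 2)\<^sup>2 + B\<^sup>2" unfolding r_def by auto
  \<comment> \<open>The polar angle. For \<open>r = 0\<close> the form is a multiple of the identity
    and any angle works.\<close>
  obtain t where t: "r * cos t = (A - E) / 2" "r * sin t = B"
  proof (cases "r = 0")
    case True
    with r2 have "(A - E) / 2 = 0" "B = 0" by (auto simp: sum_power2_eq_zero_iff)
    with True that[of 0] show ?thesis by simp
  next
    case False
    then have "((A - E) / 2 / r)\<^sup>2 + (B / r)\<^sup>2 = 1"
      unfolding power_divide[of _ r] add_divide_distrib[symmetric] r2[symmetric] by simp
    then obtain t where "(A - E) / 2 / r = cos t" "B / r = sin t" by (rule sincos_total_2pi)
    with False that[of t] show ?thesis by (simp add: field_simps)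
  qed
  define \<alpha> where "\<alpha> = cos (t / 2)"
  define \<beta> where "\<beta> = sin (t / 2)"
  define \<nu> where "\<nu> = (A + E) / 2 + r"
  define \<mu> where "\<mu> = (A + E) / 2 - r"
  have ab: "\<alpha>\<^sup>2 + \<beta>\<^sup>2 = 1" by (simp add: \<alpha>_def \<beta>_def)
  have c: "r * (\<alpha>\<^sup>2 - \<beta>\<^sup>2) = (A - E) / 2" and s: "r * (2 * \<beta> * \<alpha>) = B"
    using t cos_double[of "t / 2"] sin_double[of "t / 2"] by (simp_all add: \<alpha>_def \<beta>_def)
  have "\<nu> * \<alpha>\<^sup>2 + \<mu> * \<beta>\<^sup>2 = (A + E) / 2 * (\<alpha>\<^sup>2 + \<beta>\<^sup>2) + r * (\<alpha>\<^sup>2 - \<beta>\<^sup>2)"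
    "\<nu> * \<beta>\<^sup>2 + \<mu> * \<alpha>\<^sup>2 = (A + E) / 2 * (\<alpha>\<^sup>2 + \<beta>\<^sup>2) - r * (\<alpha>\<^sup>2 - \<beta>\<^sup>2)"
    "(\<nu> - \<mu>) * (\<alpha> * \<beta>) = r * (2 * \<beta> * \<alpha>)"
    unfolding \<nu>_def \<mu>_def by (simp_all add: distrib_right left_diff_distrib right_diff_distrib distrib_left)
  then have co: "\<nu> * \<alpha>\<^sup>2 + \<mu> * \<beta>\<^sup>2 = A" "\<nu> * \<beta>\<^sup>2 + \<mu> * \<alpha>\<^sup>2 = E" "(\<nu> - \<mu>) * (\<alpha> * \<beta>) = B"
    unfolding ab c s by (simp_all add: field_simps)
  show thesis
  proof
    show "\<alpha>\<^sup>2 + \<beta>\<^sup>2 = 1" by fact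
    show "\<mu> \<le> \<nu>" using r0 by (simp add: \<nu>_def \<mu>_def)
    have "\<nu> * \<mu> = ((A + E) / 2)\<^sup>2 - r\<^sup>2" by (simp add: \<nu>_def \<mu>_def power2_eq_square algebra_simps)
    also have "\<dots> = A * E - B\<^sup>2" unfolding r2 by (simp add: power2_eq_square field_simps)
    finally show "\<nu> * \<mu> = A * E - B\<^sup>2" .
    show "A * X\<^sup>2 + 2 * B * X * Y + E * Y\<^sup>2 = \<nu> * (\<alpha> * X + \<beta> * Y)\<^sup>2 + \<mu> * (- \<beta> * X + \<alpha> * Y)\<^sup>2" for X Y
      unfolding co[symmetric] by algebra
  qed
qed

lemma parabola_of_affine_equation:
  fixes p e1 e2 :: "real^2"
  assumes D: "det (col_matrix e1 e2) \<noteq> 0"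
  obtains S where "parabola S" "\<And>x y. x\<^sup>2 = 2 * y \<Longrightarrow> p + x *\<^sub>R e1 + y *\<^sub>R e2 \<in> S"
proof -
  text \<open>\<open>(\<alpha>, \<beta>)\<close> is orthogonal to the axis direction \<open>e2\<close>; in the rotated coordinates
    \<open>(X, Y)\<close> the curve is \<open>X = a x\<close>, \<open>Y = b x + n x\<^sup>2 / 2\<close>.\<close>
  define n where "n = sqrt ((e2$1)\<^sup>2 + (e2$2)\<^sup>2)"
  have n2: "n\<^sup>2 = (e2$1)\<^sup>2 + (e2$2)\<^sup>2" by (simp add: n_def)
  have "e2$1 \<noteq> 0 \<or> e2$2 \<noteq> 0" using D by (auto simp: det_col_matrix)
  then have n: "n > 0" unfolding n_def by (simp add: sum_power2_gt_zero_iff)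
  define \<alpha> where "\<alpha> = e2$2 / n"
  define \<beta> where "\<beta> = - e2$1 / n"
  have ab: "\<alpha>\<^sup>2 + \<beta>\<^sup>2 = 1"
  proof -
    have "(e2$2)\<^sup>2 + (- e2$1)\<^sup>2 = n\<^sup>2" by (simp add: n2)
    with n show ?thesis
      unfolding \<alpha>_def \<beta>_def power_divide add_divide_distrib[symmetric] by simp
  qed
  define a where "a = \<alpha> * e1$1 + \<beta> * e1$2"
  define b where "b = - \<beta> * e1$1 + \<alpha> * e1$2"
  have e2: "\<alpha> * e2$1 + \<beta> * e2$2 = 0" "- \<beta> * e2$1 + \<alpha> * e2$2 = n"
    using n n2 by (simp_all add: \<alpha>_def \<beta>_def field_simps power2_eq_square)
  \<comment> \<open>In fact \<open>a = det (col_matrix e1 e2) / n\<close>.\<close>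
  have a0: "a \<noteq> 0"
    using D n unfolding a_def \<alpha>_def \<beta>_def by (simp add: det_col_matrix field_simps)
  \<comment> \<open>Eliminating \<open>x\<close> gives \<open>Y = A X^2 + (b / a) X\<close>;
    completing the square turns this into \<open>Y + A h^2 = A (X + h)^2\<close>.\<close>
  define A where "A = n / (2 * a\<^sup>2)"
  have A: "A > 0" using n a0 by (simp add: A_def)
  define h where "h = b / (2 * A * a)"
  define S :: "(real^2) set" where "S = {z. - \<beta> * (z$1 - p$1) + \<alpha> * (z$2 - p$2) + A * h\<^sup>2
      = A * (\<alpha> * (z$1 - p$1) + \<beta> * (z$2 - p$2) + h)\<^sup>2}"
  have "congruent_sets S {z. z$2 = A * (z$1)\<^sup>2}"
  proof (rule congruent_sets_rotation[OF ab])
    fix z :: "real^2"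
    \<comment> \<open>The vertex, whose rotated coordinates relative to \<open>p\<close> are
      \<open>(- h, - A h^2)\<close>.\<close>
    let ?c = "p - vector [\<alpha> * h - \<beta> * (A * h\<^sup>2), \<beta> * h + \<alpha> * (A * h\<^sup>2)]"
    have ab': "\<alpha> * \<alpha> + \<beta> * \<beta> = 1" using ab by (simp add: power2_eq_square)
    have 1: "z$1 - ?c$1 = (z$1 - p$1) + (\<alpha> * h - \<beta> * (A * h\<^sup>2))"
      "z$2 - ?c$2 = (z$2 - p$2) + (\<beta> * h + \<alpha> * (A * h\<^sup>2))"
      by simp_all
    have 2: "\<alpha> * (X + (\<alpha> * h - \<beta> * H)) + \<beta> * (Y + (\<beta> * h + \<alpha> * H))
        = \<alpha> * X + \<beta> * Y + (\<alpha> * \<alpha> + \<beta> * \<beta>) * h"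
      "- \<beta> * (X + (\<alpha> * h - \<beta> * H)) + \<alpha> * (Y + (\<beta> * h + \<alpha> * H))
        = - \<beta> * X + \<alpha> * Y + (\<alpha> * \<alpha> + \<beta> * \<beta>) * H" for X Y H
      by (simp_all add: algebra_simps)
    show "z \<in> S \<longleftrightarrow> vector [\<alpha> * (z$1 - ?c$1) + \<beta> * (z$2 - ?c$2), - \<beta> * (z$1 - ?c$1) + \<alpha> * (z$2 - ?c$2)]
      \<in> {z :: real^2. z$2 = A * (z$1)\<^sup>2}"
      unfolding 1 2 ab' by (simp add: S_def)
  qed
  moreover have "p + x *\<^sub>R e1 + y *\<^sub>R e2 \<in> S" if "x\<^sup>2 = 2 * y" for x y
  proof -
    let ?z = "p + x *\<^sub>R e1 + y *\<^sub>R e2"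
    have "\<alpha> * (?z$1 - p$1) + \<beta> * (?z$2 - p$2) = x * a + y * (\<alpha> * e2$1 + \<beta> * e2$2)"
      by (simp add: a_def algebra_simps)
    then have X: "\<alpha> * (?z$1 - p$1) + \<beta> * (?z$2 - p$2) = x * a" by (simp add: e2)
    have "- \<beta> * (?z$1 - p$1) + \<alpha> * (?z$2 - p$2) = x * b + y * (- \<beta> * e2$1 + \<alpha> * e2$2)"
      by (simp add: b_def algebra_simps)
    then have Y: "- \<beta> * (?z$1 - p$1) + \<alpha> * (?z$2 - p$2) = x * b + y * n" by (simp only: e2)
    have "A * a\<^sup>2 = n / 2" "2 * A * a * h = b" using a0 n by (simp_all add: A_def h_def)
    then have "x * b + y * n + A * h\<^sup>2 = A * (x * a + h)\<^sup>2" using that by algebra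
    then show ?thesis unfolding S_def mem_Collect_eq X Y .
  qed
  ultimately show thesis using that A unfolding parabola_def by blast
qed

lemma central_conic_of_affine_equation:
  fixes p e1 e2 :: "real^2"
  assumes D: "det (col_matrix e1 e2) \<noteq> 0" and k: "k \<noteq> 0"
  obtains S where "ellipse S \<or> hyperbola S"
    "\<And>x y. x\<^sup>2 + k * y\<^sup>2 = 2 * y \<Longrightarrow> p + x *\<^sub>R e1 + y *\<^sub>R e2 \<in> S"
proof -
  define d where "d = det (col_matrix e1 e2)"
  have d: "d \<noteq> 0" "d = e1$1 * e2$2 - e1$2 * e2$1" using D by (auto simp: d_def det_col_matrix)
  \<comment> \<open>The center: \<open>x^2 + k y^2 = 2 y\<close> is symmetric about the point
    \<open>(0, 1 / k)\<close>.\<close>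
  define c where "c = p + (1 / k) *\<^sub>R e2"
  text \<open>With \<open>(X, Y) = z - c\<close>, Cramer's rule turns \<open>k x\<^sup>2 + (k y - 1)\<^sup>2\<close> into a quadratic form.\<close>
  define A where "A = (k * (e2$2)\<^sup>2 + k\<^sup>2 * (e1$2)\<^sup>2) / d\<^sup>2"
  define B where "B = - (k * e2$1 * e2$2 + k\<^sup>2 * e1$1 * e1$2) / d\<^sup>2"
  define E where "E = (k * (e2$1)\<^sup>2 + k\<^sup>2 * (e1$1)\<^sup>2) / d\<^sup>2"
  obtain \<alpha> \<beta> \<nu> \<mu> where ab: "\<alpha>\<^sup>2 + \<beta>\<^sup>2 = 1" and le: "\<mu> \<le> \<nu>" and lm: "\<nu> * \<mu> = A * E - B\<^sup>2"
    and form: "\<And>X Y. A * X\<^sup>2 + 2 * B * X * Y + E * Y\<^sup>2 = \<nu> * (\<alpha> * X + \<beta> * Y)\<^sup>2 + \<mu> * (- \<beta> * X + \<alpha> * Y)\<^sup>2"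
    using quadratic_form_diagonalization[of A E B] by metis
  \<comment> \<open>The form has determinant \<open>k * k^2\<close> in the affine coordinates, and
    the change of basis divides it by \<open>d^2\<close>. Thus the product of the eigenvalues has
    the sign of \<open>k\<close>.\<close>
  have "(A * E - B\<^sup>2) * (d\<^sup>2 * d\<^sup>2) = (A * d\<^sup>2) * (E * d\<^sup>2) - (B * d\<^sup>2)\<^sup>2"
    by (simp add: power2_eq_square algebra_simps)
  also have "\<dots> = k ^ 3 * (d\<^sup>2)"
    using d(1) by (simp add: A_def B_def E_def) (simp add: d(2) power2_eq_square power3_eq_cube algebra_simps)
  finally have "((A * E - B\<^sup>2) * d\<^sup>2) * d\<^sup>2 = k ^ 3 * d\<^sup>2"
    by (simp only: mult.assoc)
  then have "(A * E - B\<^sup>2) * d\<^sup>2 = k ^ 3"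
    using d(1) by (simp only: mult_right_cancel power_not_zero not_False_eq_True)
  then have det: "\<nu> * \<mu> = k ^ 3 / d\<^sup>2"
    unfolding lm using d(1) by (simp add: eq_divide_eq)
  define S :: "(real^2) set" where "S = {z. \<nu> * (\<alpha> * (z$1 - c$1) + \<beta> * (z$2 - c$2))\<^sup>2 + \<mu> * (- \<beta> * (z$1 - c$1) + \<alpha> * (z$2 - c$2))\<^sup>2 = 1}"
  have mem: "p + x *\<^sub>R e1 + y *\<^sub>R e2 \<in> S" if xy: "x\<^sup>2 + k * y\<^sup>2 = 2 * y" for x y
  proof -
    define Y where "Y = y - 1 / k"
    have z: "(p + x *\<^sub>R e1 + y *\<^sub>R e2) $ i - c $ i = x * e1$i + Y * e2$i" for i
      by (simp add: c_def Y_def algebra_simps)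
    have "(A * d\<^sup>2) * (x * e1$1 + Y * e2$1)\<^sup>2 + 2 * (B * d\<^sup>2) * (x * e1$1 + Y * e2$1) * (x * e1$2 + Y * e2$2)
        + (E * d\<^sup>2) * (x * e1$2 + Y * e2$2)\<^sup>2 = d\<^sup>2 * (k * x\<^sup>2 + (k * Y)\<^sup>2)"
      using d(1) by (simp add: A_def B_def E_def) (simp add: d(2), algebra)
    then have "d\<^sup>2 * (A * (x * e1$1 + Y * e2$1)\<^sup>2 + 2 * B * (x * e1$1 + Y * e2$1) * (x * e1$2 + Y * e2$2)
        + E * (x * e1$2 + Y * e2$2)\<^sup>2) = d\<^sup>2 * (k * x\<^sup>2 + (k * Y)\<^sup>2)"
      by (simp add: algebra_simps)
    then have "A * (x * e1$1 + Y * e2$1)\<^sup>2 + 2 * B * (x * e1$1 + Y * e2$1) * (x * e1$2 + Y * e2$2)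
        + E * (x * e1$2 + Y * e2$2)\<^sup>2 = k * x\<^sup>2 + (k * Y)\<^sup>2"
      using d(1) by simp
    also have "k * Y = k * y - 1" using k by (simp add: Y_def algebra_simps)
    also have "k * x\<^sup>2 + (k * y - 1)\<^sup>2 = 1" using xy by algebra
    finally show ?thesis unfolding S_def mem_Collect_eq z form .
  qed
  \<comment> \<open>For positive \<open>k\<close> the eigenvalues have equal signs and nonnegative
    sum, so both are positive; for negative \<open>k\<close> their signs differ and
    \<open>\<mu> \<le> \<nu>\<close> tells which is which.\<close>
  have "ellipse S \<or> hyperbola S"
  proof (cases "k > 0")
    case True
    have "A \<ge> 0" "E \<ge> 0" using True by (simp_all add: A_def E_def)
    moreover have "\<nu> * \<mu> > 0" unfolding det using True d(1) by simp
    moreover have "\<nu> + \<mu> = A + E"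
    proof -
      have "A + E = (\<nu> + \<mu>) * (\<alpha>\<^sup>2 + \<beta>\<^sup>2)"
        using form[of 1 0] form[of 0 1] by (simp add: algebra_simps)
      then show ?thesis using ab by simp
    qed
    ultimately have pos: "\<nu> > 0" "\<mu> > 0" using le by (auto simp: zero_less_mult_iff)
    have "congruent_sets S {z. (z$1)\<^sup>2 / (1 / sqrt \<nu>)\<^sup>2 + (z$2)\<^sup>2 / (1 / sqrt \<mu>)\<^sup>2 = 1}"
      by (rule congruent_sets_rotation[OF ab, of _ c]) (use pos in \<open>simp add: S_def power_divide mult.commute\<close>)
    then show ?thesis using pos unfolding ellipse_def by (meson real_sqrt_gt_zero zero_less_divide_1_iff)
  next
    case False
    then have "\<nu> * \<mu> < 0" unfolding det using d(1) k by (simp add: divide_less_0_iff power_less_zero_eq)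
    then have pos: "\<nu> > 0" "- \<mu> > 0" using le by (auto simp: mult_less_0_iff)
    have "congruent_sets S {z. (z$1)\<^sup>2 / (1 / sqrt \<nu>)\<^sup>2 - (z$2)\<^sup>2 / (1 / sqrt (- \<mu>))\<^sup>2 = 1}"
      by (rule congruent_sets_rotation[OF ab, of _ c]) (use pos in \<open>simp add: S_def power_divide mult.commute\<close>)
    then show ?thesis using pos unfolding hyperbola_def by (meson real_sqrt_gt_zero zero_less_divide_1_iff)
  qed
  then show thesis using that mem by blast
qed

lemma conic_arc_imp_arc_of_conic:
  assumes "curve I \<gamma>" "conic_arc I \<gamma>"
  shows "\<exists>S. (parabola S \<or> ellipse S \<or> hyperbola S) \<and> arc_of I \<gamma> S"
proof -
  from assms(2) obtain k p e1 e2 u where D: "det (col_matrix e1 e2) \<noteq> 0"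
    and eq: "\<And>s. s \<in> I \<Longrightarrow> \<gamma> s = p + gsin k (u s) *\<^sub>R e1 + gver k (u s) *\<^sub>R e2"
    unfolding conic_arc_def by blast
  obtain S where "parabola S \<or> ellipse S \<or> hyperbola S"
    and S: "\<And>x y. x\<^sup>2 + k * y\<^sup>2 = 2 * y \<Longrightarrow> p + x *\<^sub>R e1 + y *\<^sub>R e2 \<in> S"
  proof (cases "k = 0")
    case True
    with parabola_of_affine_equation[OF D] that show ?thesis by (metis add.right_neutral mult_zero_left)
  next
    case False
    with central_conic_of_affine_equation[OF D] that show ?thesis by metis
  qed
  moreover have "\<gamma> ` I \<subseteq> S" using eq S[OF gsin_gver_conic] by auto
  ultimately show ?thesis using assms(1) unfolding arc_of_def by blast
qed

section \<open>From a curve inside a conic to its normal form\<close>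

text \<open>The origin is put at a vertex, \<open>e1\<close> along the tangent and \<open>e2\<close>
  along the axis; scaling then yields \<open>k = 0\<close>, \<open>k = 1\<close> and
  \<open>k = - 1\<close> for the parabola, the ellipse and the hyperbola. The isometry of the
  congruence carries this frame along.\<close>

lemma affine_equation_of_conic:
  assumes "parabola S \<or> ellipse S \<or> hyperbola S"
  obtains k p e1 e2 where "det (col_matrix e1 e2) \<noteq> 0"
    "\<And>z. z \<in> S \<Longrightarrow> \<exists>x y. z = p + x *\<^sub>R e1 + y *\<^sub>R e2 \<and> x\<^sup>2 + k * y\<^sup>2 = 2 * y"
proof -
  note conicI = that
  have frame: thesis if S: "S = (\<lambda>z. R *v z + c) ` T" and R: "orthogonal_matrix R" and ne: "a \<noteq> 0" "b \<noteq> 0"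
    and T: "\<And>z. z \<in> T \<Longrightarrow> \<exists>x y. z = q + x *\<^sub>R vector [a, 0] + y *\<^sub>R vector [0, b] \<and> x\<^sup>2 + k * y\<^sup>2 = 2 * y"
    for R c T a b q k
  proof (rule conicI)
    have "det R \<noteq> 0" using det_orthogonal_matrix[OF R] by auto
    then have "det R * det (col_matrix (vector [a, 0]) (vector [0, b])) \<noteq> 0"
      using ne by (simp add: det_col_matrix)
    then show "det (col_matrix (R *v vector [a, 0]) (R *v vector [0, b])) \<noteq> 0"
      unfolding det_mul[symmetric] matrix_mult_col_matrix .
    fix z assume "z \<in> S"
    then obtain w where w: "w \<in> T" "z = R *v w + c" using S by blast
    with T[OF w(1)] obtain x y where "w = q + x *\<^sub>R vector [a, 0] + y *\<^sub>R vector [0, b]" "x\<^sup>2 + k * y\<^sup>2 = 2 * y"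
      by blast
    then show "\<exists>x y. z = (R *v q + c) + x *\<^sub>R (R *v vector [a, 0]) + y *\<^sub>R (R *v vector [0, b]) \<and> x\<^sup>2 + k * y\<^sup>2 = 2 * y"
      using w(2) by (intro exI[of _ x] exI[of _ y])
        (simp add: matrix_vector_right_distrib matrix_vector_mult_scaleR algebra_simps)
  qed
  from assms consider (parabola) "parabola S" | (ellipse) "ellipse S" | (hyperbola) "hyperbola S" by blast
  then show thesis
  proof cases
    case parabola
    then obtain a R c where a: "a > 0" and R: "orthogonal_matrix R"
      and S: "S = (\<lambda>z. R *v z + c) ` {z. z$2 = a * (z$1)\<^sup>2}"
      unfolding parabola_def congruent_sets_def by blast
    show ?thesis
    proof (rule frame[OF S R, of 1 "2 * a" 0 0])
      fix z :: "real^2" assume "z \<in> {z. z$2 = a * (z$1)\<^sup>2}"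
      then show "\<exists>x y. z = 0 + x *\<^sub>R vector [1, 0] + y *\<^sub>R vector [0, 2 * a] \<and> x\<^sup>2 + 0 * y\<^sup>2 = 2 * y"
        by (intro exI[of _ "z$1"] exI[of _ "(z$1)\<^sup>2 / 2"]) (simp add: vec_eq_iff forall_2)
    qed (use a in auto)
  next
    case ellipse
    then obtain a b R c where ab: "a > 0" "b > 0" and R: "orthogonal_matrix R"
      and S: "S = (\<lambda>z. R *v z + c) ` {z. (z$1)\<^sup>2 / a\<^sup>2 + (z$2)\<^sup>2 / b\<^sup>2 = 1}"
      unfolding ellipse_def congruent_sets_def by blast
    show ?thesis
    proof (rule frame[OF S R, of a b "vector [0, - b]" 1])
      fix z :: "real^2" assume "z \<in> {z. (z$1)\<^sup>2 / a\<^sup>2 + (z$2)\<^sup>2 / b\<^sup>2 = 1}"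
      then have "(z$1 / a)\<^sup>2 + (z$2 / b)\<^sup>2 = 1" by (simp add: power_divide)
      then have "(z$1 / a)\<^sup>2 + 1 * (1 + z$2 / b)\<^sup>2 = 2 * (1 + z$2 / b)"
        by (simp add: power2_sum)
      moreover have "z = vector [0, - b] + (z$1 / a) *\<^sub>R vector [a, 0] + (1 + z$2 / b) *\<^sub>R vector [0, b]"
        using ab by (simp add: vec_eq_iff forall_2 field_simps)
      ultimately show "\<exists>x y. z = vector [0, - b] + x *\<^sub>R vector [a, 0] + y *\<^sub>R vector [0, b] \<and> x\<^sup>2 + 1 * y\<^sup>2 = 2 * y"
        by blast
    qed (use ab in auto)
  next
    case hyperbola
    then obtain a b R c where ab: "a > 0" "b > 0" and R: "orthogonal_matrix R"
      and S: "S = (\<lambda>z. R *v z + c) ` {z. (z$1)\<^sup>2 / a\<^sup>2 - (z$2)\<^sup>2 / b\<^sup>2 = 1}"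
      unfolding hyperbola_def congruent_sets_def by blast
    \<comment> \<open>Swaps the coordinates so that the transverse axis of the hyperbola becomes the
      direction of \<open>e2\<close>, with vertex \<open>(0, a)\<close>.\<close>
    let ?P = "col_matrix (vector [0, 1]) (vector [1, 0]) :: real^2^2"
    have P: "?P *v z = vector [z$2, z$1]" for z :: "real^2"
      by (simp add: col_matrix_mult vec_eq_iff forall_2)
    have S': "S = (\<lambda>z. (R ** ?P) *v z + c) ` {z. (z$2)\<^sup>2 / a\<^sup>2 - (z$1)\<^sup>2 / b\<^sup>2 = 1}"
    proof -
      have "{z::real^2. (z$1)\<^sup>2 / a\<^sup>2 - (z$2)\<^sup>2 / b\<^sup>2 = 1} = (\<lambda>z. ?P *v z) ` {z. (z$2)\<^sup>2 / a\<^sup>2 - (z$1)\<^sup>2 / b\<^sup>2 = 1}"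
      proof (intro set_eqI iffI)
        fix z :: "real^2" assume "z \<in> {z. (z$1)\<^sup>2 / a\<^sup>2 - (z$2)\<^sup>2 / b\<^sup>2 = 1}"
        then show "z \<in> (\<lambda>z. ?P *v z) ` {z. (z$2)\<^sup>2 / a\<^sup>2 - (z$1)\<^sup>2 / b\<^sup>2 = 1}"
          by (intro image_eqI[of _ _ "vector [z$2, z$1]"]) (auto simp: P vec_eq_iff forall_2)
      qed (auto simp: P)
      then show ?thesis unfolding S by (simp add: image_image matrix_vector_mul_assoc)
    qed
    have "orthogonal_matrix ?P"
      by (simp add: orthogonal_matrix col_matrix_def transpose_def matrix_matrix_mult_def mat_def
          vec_eq_iff forall_2 sum_2)
    then have R': "orthogonal_matrix (R ** ?P)" by (rule orthogonal_matrix_mul[OF R])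
    show ?thesis
    proof (rule frame[OF S' R', of b a "vector [0, a]" "- 1"])
      fix z :: "real^2" assume "z \<in> {z. (z$2)\<^sup>2 / a\<^sup>2 - (z$1)\<^sup>2 / b\<^sup>2 = 1}"
      then have "(z$2 / a)\<^sup>2 - (z$1 / b)\<^sup>2 = 1" by (simp add: power_divide)
      then have "(z$1 / b)\<^sup>2 + - 1 * (z$2 / a - 1)\<^sup>2 = 2 * (z$2 / a - 1)"
        by (simp add: power2_diff)
      moreover have "z = vector [0, a] + (z$1 / b) *\<^sub>R vector [b, 0] + (z$2 / a - 1) *\<^sub>R vector [0, a]"
        using ab by (simp add: vec_eq_iff forall_2 field_simps)
      ultimately show "\<exists>x y. z = vector [0, a] + x *\<^sub>R vector [b, 0] + y *\<^sub>R vector [0, a] \<and> x\<^sup>2 + - 1 * y\<^sup>2 = 2 * y"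
        by blast
    qed (use ab in auto)
  qed
qed

text \<open>The parameter \<open>u\<close> comes from integration instead of inverting
  \<open>gsin\<close> and \<open>gver\<close>, and the frame is taken at \<gamma>\<open>(0)\<close>.
  This covers repeated turns around an ellipse and both branches of a hyperbola.\<close>

lemma affine_equation_imp_conic_arc:
  assumes \<gamma>: "smooth_on_interval {0..l} \<gamma>" and l: "0 < l" and D: "det (col_matrix e1 e2) \<noteq> 0"
    and eq: "\<And>s. s \<in> {0..l} \<Longrightarrow> \<exists>x y. \<gamma> s = p + x *\<^sub>R e1 + y *\<^sub>R e2 \<and> x\<^sup>2 + k * y\<^sup>2 = 2 * y"
  shows "conic_arc {0..l} \<gamma>"
proof -
  let ?I = "{0..l}"
  have I: "nondegenerate_interval ?I" by (rule nondegenerate_interval_Icc[OF l])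
  define d where "d = det (col_matrix e1 e2)"
  \<comment> \<open>The hypothesis gives coordinates only pointwise; Cramer's rule expresses them
    linearly in \<gamma>, which makes them smooth.\<close>
  define x where "x s = det (col_matrix (\<gamma> s - p) e2) / d" for s
  define y where "y s = det (col_matrix e1 (\<gamma> s - p)) / d" for s
  have \<gamma>_eq: "\<gamma> s = p + x s *\<^sub>R e1 + y s *\<^sub>R e2" for s
    using cramer_col_matrix[OF D, of "\<gamma> s - p"] unfolding x_def y_def d_def by (simp add: algebra_simps)
  have conic: "(x s)\<^sup>2 + k * (y s)\<^sup>2 = 2 * y s" if s: "s \<in> ?I" for s
  proof -
    from eq[OF s] obtain a b where ab: "\<gamma> s = p + a *\<^sub>R e1 + b *\<^sub>R e2" "a\<^sup>2 + k * b\<^sup>2 = 2 * b" by blast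
    have "det (col_matrix (\<gamma> s - p) e2) = a * d" "det (col_matrix e1 (\<gamma> s - p)) = b * d"
      unfolding ab(1) d_def det_col_matrix by (simp_all add: algebra_simps)
    then have "x s = a" "y s = b" using D by (simp_all add: x_def y_def d_def)
    with ab show ?thesis by simp
  qed
  have "linear (\<lambda>z. det (col_matrix z e2) / d)" "linear (\<lambda>z. det (col_matrix e1 z) / d)"
    by (rule linearI; simp add: det_col_matrix algebra_simps add_divide_distrib diff_divide_distrib)+
  note lin = this[unfolded linear_conv_bounded_linear]
  have xs: "smooth_on_interval ?I x"
    using smooth_on_interval_bounded_linear[OF I \<gamma> lin(1), of "- det (col_matrix p e2) / d"]
    unfolding x_def by (simp add: det_col_matrix algebra_simps diff_divide_distrib add_divide_distrib)
  have ys: "smooth_on_interval ?I y"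
    using smooth_on_interval_bounded_linear[OF I \<gamma> lin(2), of "- det (col_matrix e1 p) / d"]
    unfolding y_def by (simp add: det_col_matrix algebra_simps diff_divide_distrib add_divide_distrib)
  let ?x' = "deriv_on ?I x" and ?y' = "deriv_on ?I y"
  text \<open>On the normal form \<open>x = gsin k u\<close>, \<open>y = gver k u\<close> this is the derivative of \<open>u\<close>.\<close>
  define w where "w s = (1 - k * y s) * ?x' s + k * x s * ?y' s" for s
  have ws: "smooth_on_interval ?I w"
  proof -
    have "smooth_on_interval ?I (\<lambda>s. 1 - k * y s)" "smooth_on_interval ?I (\<lambda>s. k * x s)"
      using smooth_on_interval_bounded_linear[OF I ys bounded_linear_mult_right[of "- k"], of 1]
        smooth_on_interval_bounded_linear[OF I xs bounded_linear_mult_right[of k], of 0] by simp_all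
    note gen = this[THEN smooth_generated.base]
      smooth_generated.base[OF smooth_on_interval_deriv[OF xs]]
      smooth_generated.base[OF smooth_on_interval_deriv[OF ys]]
    from smooth_generated_imp_smooth[OF I smooth_generated.add[OF
        smooth_generated.mult[OF gen(1,3)] smooth_generated.mult[OF gen(2,4)]]]
    show ?thesis unfolding w_def .
  qed
  have cont: "continuous_on ?I w"
    unfolding continuous_on_eq_continuous_within
    using smooth_on_interval_has_deriv[OF ws] has_vector_derivative_continuous by blast
  define u where "u s = integral {0..s} w" for s
  have u: "(u has_vector_derivative w s) (at s within ?I)" if "s \<in> ?I" for s
    unfolding u_def by (rule integral_has_vector_derivative[OF cont that])
  have us: "smooth_on_interval ?I u"
    by (rule smooth_on_interval_antiderivative[OF I ws u])
  have dx: "(x has_real_derivative ?x' s) (at s within ?I)" and dy: "(y has_real_derivative ?y' s) (at s within ?I)"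
    if "s \<in> ?I" for s
    using smooth_on_interval_has_deriv[OF xs that] smooth_on_interval_has_deriv[OF ys that]
    by (simp_all add: has_real_derivative_iff_has_vector_derivative)
  have ode: "?x' s = w s * (1 - k * y s)" "?y' s = w s * x s" if s: "s \<in> ?I" for s
  proof -
    have "((\<lambda>s. (x s)\<^sup>2 + k * (y s)\<^sup>2 - 2 * y s) has_real_derivative
        2 * (x s * ?x' s + k * y s * ?y' s - ?y' s)) (at s within ?I)"
      using dx[OF s] dy[OF s] by (auto intro!: derivative_eq_intros simp: algebra_simps)
    then have "deriv_on ?I (\<lambda>s. (x s)\<^sup>2 + k * (y s)\<^sup>2 - 2 * y s) s = 2 * (x s * ?x' s + k * y s * ?y' s - ?y' s)"
      by (intro deriv_on_eqI[OF I s]) (simp add: has_real_derivative_iff_has_vector_derivative)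
    moreover have "deriv_on ?I (\<lambda>s. (x s)\<^sup>2 + k * (y s)\<^sup>2 - 2 * y s) s = deriv_on ?I (\<lambda>_. 0) s"
      by (rule deriv_on_cong) (use conic s in auto)
    moreover have "deriv_on ?I (\<lambda>_. 0) s = (0::real)"
      by (rule deriv_on_eqI[OF I s]) simp
    ultimately have tangent: "x s * ?x' s + k * y s * ?y' s - ?y' s = 0" by simp
    \<comment> \<open>By \<open>tangent\<close>, \<open>x x' = (1 - k y) y'\<close>. Together with
      \<open>(1 - k y)^2 + k x^2 = 1\<close>, which is the conic equation times \<open>k\<close>,
      this recovers both derivatives from \<open>w\<close>.\<close>
    show "?x' s = w s * (1 - k * y s)" "?y' s = w s * x s"
      using tangent conic[OF s] unfolding w_def by algebra+
  qed
  \<comment> \<open>\<open>V\<close> is the derivative of the normal form with respect to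
    \<open>u\<close>, and \<open>W\<close> the second one, both written in terms of the point
    \<open>(x, y)\<close>.\<close>
  define V where "V s = (1 - k * y s) *\<^sub>R e1 + x s *\<^sub>R e2" for s
  define W where "W s = (- k * x s) *\<^sub>R e1 + (1 - k * y s) *\<^sub>R e2" for s
  have dC: "((\<lambda>s. 1 - k * y s) has_real_derivative - k * ?y' s) (at s within ?I)" if "s \<in> ?I" for s
    using dy[OF that] by (auto intro!: derivative_eq_intros)
  have "\<gamma> s = \<gamma> 0 + gsin k (u s - u 0) *\<^sub>R V 0 + gver k (u s - u 0) *\<^sub>R W 0" if "s \<in> ?I" for s
  proof (rule frenet_solution[of ?I, where u' = w])
    fix s assume s: "s \<in> ?I"
    show "(u has_real_derivative w s) (at s within ?I)"
      using u[OF s] by (simp add: has_real_derivative_iff_has_vector_derivative)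
    have "(\<gamma> has_vector_derivative ?x' s *\<^sub>R e1 + ?y' s *\<^sub>R e2) (at s within ?I)"
      using has_vector_derivative_combination[OF dx[OF s] dy[OF s], of p e1 e2] unfolding \<gamma>_eq[symmetric] .
    then show "(\<gamma> has_vector_derivative w s *\<^sub>R V s) (at s within ?I)"
      unfolding ode[OF s] V_def by (simp add: scaleR_add_right)
    show "(V has_vector_derivative w s *\<^sub>R W s) (at s within ?I)"
      using has_vector_derivative_combination[OF dC[OF s] dx[OF s], of 0 e1 e2]
      unfolding ode[OF s] V_def W_def by (simp add: scaleR_add_right scaleR_diff_right mult.left_commute mult.commute)
    show "(W has_vector_derivative - (k * w s) *\<^sub>R V s) (at s within ?I)"
      using has_vector_derivative_combination[OF DERIV_cmult[OF dx[OF s], of "- k"] dC[OF s], of 0 e1 e2]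
      unfolding ode[OF s] V_def W_def by (simp add: scaleR_add_right scaleR_diff_right mult.assoc)
  qed (use l that in auto)
  \<comment> \<open>The transition from \<open>e1\<close>, \<open>e2\<close> to \<open>V 0\<close>,
    \<open>W 0\<close> has determinant \<open>(1 - k y)^2 + k x^2 = 1\<close>.\<close>
  moreover have "det (col_matrix (V 0) (W 0)) \<noteq> 0"
  proof -
    have "(x 0)\<^sup>2 + k * (y 0)\<^sup>2 = 2 * y 0" using conic[of 0] l by simp
    then have "(1 - k * y 0) * (1 - k * y 0) - x 0 * (- k * x 0) = 1" by algebra
    then show ?thesis unfolding V_def W_def det_col_matrix_combination using D by simp
  qed
  moreover have "smooth_on_interval ?I (\<lambda>s. u s - u 0)"
    using smooth_on_interval_bounded_linear[OF I us bounded_linear_ident, of "- u 0"] by simp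
  ultimately show ?thesis unfolding conic_arc_def
    by (intro exI[of _ k] exI[of _ "\<gamma> 0"] exI[of _ "V 0"] exI[of _ "W 0"] exI[of _ "\<lambda>s. u s - u 0"]) blast
qed

lemma arc_of_conic_imp_conic_arc:
  assumes "parabola S \<or> ellipse S \<or> hyperbola S" "arc_of {0..l} \<gamma> S" "0 < l"
  shows "conic_arc {0..l} \<gamma>"
proof -
  obtain k p e1 e2 where D: "det (col_matrix e1 e2) \<noteq> 0"
    and eq: "\<And>z. z \<in> S \<Longrightarrow> \<exists>x y. z = p + x *\<^sub>R e1 + y *\<^sub>R e2 \<and> x\<^sup>2 + k * y\<^sup>2 = 2 * y"
    using affine_equation_of_conic[OF assms(1)] by metis
  have "smooth_on_interval {0..l} \<gamma>" "\<And>s. s \<in> {0..l} \<Longrightarrow> \<gamma> s \<in> S"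
    using assms(2) by (auto simp: arc_of_def curve_def)
  then show ?thesis using affine_equation_imp_conic_arc[OF _ assms(3) D eq] by blast
qed

theorem theorem1p3:
  fixes \<gamma> :: "real \<Rightarrow> real^2" and s_all :: real
  assumes "arc_length_curve s_all \<gamma>"
  shows "(possesses_ESA equiaffine_parameter equiaffine_group s_all \<gamma>
            \<longleftrightarrow> constant_equiaffine_curvature {0..s_all} \<gamma>)
       \<and> (constant_equiaffine_curvature {0..s_all} \<gamma>
            \<longleftrightarrow> (\<exists>S. (parabola S \<or> ellipse S \<or> hyperbola S) \<and> arc_of {0..s_all} \<gamma> S))"
proof -
  have l: "0 < s_all" and \<gamma>: "curve {0..s_all} \<gamma>"
    using assms by (auto simp: arc_length_curve_def)
  note I = nondegenerate_interval_Icc[OF l]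
  have "constant_equiaffine_curvature {0..s_all} \<gamma> \<longleftrightarrow> conic_arc {0..s_all} \<gamma>"
    using constant_equiaffine_curvature_imp_conic_arc[OF _ I]
      conic_arc_imp_constant_equiaffine_curvature[OF \<gamma> l] by blast
  \<comment> \<open>Self-affinity yields the normal form first, and the equivalence just proved
    leads on to constant curvature.\<close>
  moreover have "possesses_ESA equiaffine_parameter equiaffine_group s_all \<gamma>
      \<longleftrightarrow> constant_equiaffine_curvature {0..s_all} \<gamma>"
    using calculation ESA_imp_conic_arc[OF _ l] constant_equiaffine_curvature_imp_ESA[OF assms] by blast
  moreover have "conic_arc {0..s_all} \<gamma>
      \<longleftrightarrow> (\<exists>S. (parabola S \<or> ellipse S \<or> hyperbola S) \<and> arc_of {0..s_all} \<gamma> S)"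
    using conic_arc_imp_arc_of_conic[OF \<gamma>] arc_of_conic_imp_conic_arc[OF _ _ l] by blast
  ultimately show ?thesis by blast
qed

end
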